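(* Let $\mathsf H$ be a separable real Hilbert space, let $\mathsf A\colon\mathsf H\to2^{\mathsf H}$ be a maximally monotone operator such that $\operatorname{zer}\mathsf A\ne\varnothing$, let $(\gamma_n)_{n\in\mathbb N}$ be a sequence in $]0,+\infty[$, and let $x_0\in L^2(\Omega,\mathcal F,\mathsf P;\mathsf H)$. For $n=0,1,\ldots$, take $e_n\in L^2(\Omega,\mathcal F,\mathsf P;\mathsf H)$ and $\lambda_n\in L^\infty(\Omega,\mathcal F,\mathsf P;\,]0,2[)$, and set $$x_{n+1}=x_n+\lambda_n\big(\mathsf J_{\gamma_n\mathsf A}x_n-e_n-x_n\big).$$ Suppose that, for every $n\in\mathbb N$, $\lambda_n$ is independent of $\sigma(x_0,\ldots,x_n,e_n)$, and that one of the following holds: (i) $\sum_{n\in\mathbb N}\mathsf E(\lambda_n(2-\lambda_n))=+\infty$, $\sum_{n\in\mathbb N}\sqrt{\mathsf E|\lambda_n|^2\,\mathsf E\|e_n\|^2}<+\infty$, $(\mathsf E\|e_n\|^2)_{n\in\mathbb N}$ is bounded, and $\gamma_n=1$ for every $n\in\mathbb N$. (ii) $\inf_{n\in\mathbb N}\mathsf E(\lambda_n(2-\lambda_n))>0$, $\inf_{n\in\mathbb N}\gamma_n>0$, and $\sum_{n\in\mathbb N}\sqrt{\mathsf E\|e_n\|^2}<+\infty$. (iii) $\sum_{n\in\mathbb N}\gamma_n^2=+\infty$, $\sum_{n\in\mathbb N}\sqrt{\mathsf E\|e_n\|^2}<+\infty$, and $\lambda_n=1$ $\mathsf P$-a.s.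 for every $n\in\mathbb N$. Then $(x_n)_{n\in\mathbb N}$ converges weakly $\mathsf P$-a.s. and weakly in $L^2(\Omega,\mathcal F,\mathsf P;\mathsf H)$ to a $(\operatorname{zer}\mathsf A)$-valued random variable.
   Context: $(\Omega,\mathcal F,\mathsf P)$ is a complete probability space. $L^2(\Omega,\mathcal F,\mathsf P;\mathsf H)$ is the space of (classes of a.s. equal) $\mathsf H$-valued Borel random variables $x$ with $\mathsf E\|x\|^2<+\infty$; $L^\infty(\Omega,\mathcal F,\mathsf P;\,]0,2[)$ is the set of real random variables with values in $]0,2[$ a.s. $\sigma(\cdot)$ denotes the generated $\sigma$-algebra. $\operatorname{zer}\mathsf A=\{\mathsf x\in\mathsf H\mid0\in\mathsf A\mathsf x\}$ and $\mathsf J_{\gamma\mathsf A}=(\mathrm{Id}+\gamma\mathsf A)^{-1}$ is the resolvent, a single-valued operator defined on all of $\mathsf H$. A random variable is $\mathsf S$-valued if it lies in $\mathsf S$ a.s. *)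

theory Defs
  imports "HOL-Probability.Probability"
begin

text \<open>Set-valued operators on a real Hilbert space are functions into the power set.\<close>

definition zer :: "('h::real_vector \<Rightarrow> 'h set) \<Rightarrow> 'h set" where
  "zer A = {x. 0 \<in> A x}"

definition gra :: "('h \<Rightarrow> 'h set) \<Rightarrow> ('h \<times> 'h) set" where
  "gra A = {(x, u). u \<in> A x}"

definition monotone_op :: "('h::real_inner \<Rightarrow> 'h set) \<Rightarrow> bool" where
  "monotone_op A \<longleftrightarrow>
     (\<forall>(x, u) \<in> gra A. \<forall>(y, v) \<in> gra A. 0 \<le> (x - y) \<bullet> (u - v))"

definition maximally_monotone :: "('h::real_inner \<Rightarrow> 'h set) \<Rightarrow> bool" where
  "maximally_monotone A \<longleftrightarrow>
     monotone_op A \<and> (\<forall>B. monotone_op B \<and> gra A \<subseteq> gra B \<longrightarrow> gra B = gra A)"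

definition id_plus_scaled :: "real \<Rightarrow> ('h::real_vector \<Rightarrow> 'h set) \<Rightarrow> 'h \<Rightarrow> 'h set" where
  "id_plus_scaled \<gamma> A p = {p + \<gamma> *\<^sub>R v | v. v \<in> A p}"

definition inverse_op :: "('h \<Rightarrow> 'h set) \<Rightarrow> 'h \<Rightarrow> 'h set" where
  "inverse_op B u = {p. u \<in> B p}"

text \<open>The inverse of \<open>Id + \<gamma> A\<close> is a set-valued operator; its values are
  singletons when \<open>A\<close> is maximally monotone and \<open>\<gamma> > 0\<close> (Minty), and
  \<open>the_elem\<close> is meaningful only then.\<close>

definition resolvent :: "real \<Rightarrow> ('h::real_vector \<Rightarrow> 'h set) \<Rightarrow> 'h \<Rightarrow> 'h" where
  "resolvent \<gamma> A u = the_elem (inverse_op (id_plus_scaled \<gamma> A) u)"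

text \<open>Elements of \<open>L\<^sup>2\<close> are handled through representatives, and equality of classes
  is almost sure equality.\<close>

definition L2 :: "'a measure \<Rightarrow> ('a \<Rightarrow> 'h::real_inner) set" where
  "L2 M = {f \<in> borel_measurable M. integrable M (\<lambda>\<omega>. (norm (f \<omega>))\<^sup>2)}"

text \<open>The weak topology of a Hilbert space is the one induced by the functionals
  \<open>\<lambda>z. z \<bullet> y\<close>; in \<open>L2 M\<close> the scalar product of \<open>f\<close> and \<open>g\<close> is the expectation
  of \<open>\<lambda>\<omega>. f \<omega> \<bullet> g \<omega>\<close>.\<close>

definition weakly_converges :: "(nat \<Rightarrow> 'h::real_inner) \<Rightarrow> 'h \<Rightarrow> bool" where
  "weakly_converges z l \<longleftrightarrow> (\<forall>y. (\<lambda>n. z n \<bullet> y) \<longlonglongrightarrow> l \<bullet> y)"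

definition weakly_converges_L2 ::
  "'a measure \<Rightarrow> (nat \<Rightarrow> 'a \<Rightarrow> 'h::real_inner) \<Rightarrow> ('a \<Rightarrow> 'h) \<Rightarrow> bool" where
  "weakly_converges_L2 M f l \<longleftrightarrow>
     (\<forall>n. f n \<in> L2 M) \<and> l \<in> L2 M \<and>
     (\<forall>g \<in> L2 M. (\<lambda>n. \<integral>\<omega>. f n \<omega> \<bullet> g \<omega> \<partial>M) \<longlonglongrightarrow> (\<integral>\<omega>. l \<omega> \<bullet> g \<omega> \<partial>M))"

definition generated_sigma :: "'a measure \<Rightarrow> ('a \<Rightarrow> 'b::topological_space) set \<Rightarrow> 'a set set" where
  "generated_sigma M F =
     sigma_sets (space M) (\<Union>f\<in>F. {f -` B \<inter> space M | B. B \<in> sets borel})"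

end

theory Submission
  imports Defs "HOL-Library.Diagonal_Subsequence"
begin

text \<open>
  For a zero \<open>z\<close> of \<open>A\<close> and \<open>r n = norm (J (x n) - x n)\<close>, firm nonexpansiveness of the resolvents
  bounds \<open>norm (x (n+1) - z)\<close> by \<open>norm (x n - z) + lam n * norm (e n)\<close>, with a decrease of the
  squares by \<open>lam n * (2 - lam n) * (r n)\<^sup>2\<close>. The random variables \<open>lam n * norm (e n)\<close> have summable
  \<open>L\<^sup>2\<close> norms, so their sum is in \<open>L\<^sup>2\<close>: almost every path is quasi-Fejer with respect to all zeros at
  once, and all \<open>x n\<close> are dominated by a single \<open>L\<^sup>2\<close> function. No conditional expectations are
  needed; independence only enters through
  \<open>E (lam n * (2 - lam n) * (r n)\<^sup>2) = E (lam n * (2 - lam n)) * E ((r n)\<^sup>2)\<close>, and through the analogous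
  factorization of the errors. The resulting series converges, which gives \<open>r n \<longlonglongrightarrow> 0\<close> almost
  surely in case (ii) directly and in case (i) because \<open>r n\<close> is decreasing up to summable errors;
  Opial's lemma then applies path by path. In case (iii) every path is an inexact proximal point
  iteration with summable errors. Weak convergence in \<open>L\<^sup>2\<close> is dominated convergence.
\<close>

section \<open>Minty's theorem and resolvents\<close>

text \<open>The almost sure statements live on one event defined without reference to a zero of
  \<open>A\<close>, so the possibly uncountable set \<open>zer A\<close> costs no further null sets
  and the deterministic lemmas apply to each path. Expectations can be taken because the error term
  of the squared inequality is a product of a distance and an error: both the distances and the sum
  of the errors lie below the same square-integrable function. In case (i) divergence of the
  expected weights alone would only give 0 as the lower limit of the expected squared residuals. The
  monotonicity that closes this gap compares residuals at consecutive points for one and the same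
  resolvent, which is where the constant parameter enters. In case (iii) the weights equal 1, but a
  null residual says little when the parameters are small: what must vanish is the residual divided
  by the parameter, an element of the image of \<open>A\<close>.\<close>

lemma maximally_monotone_iff:
  "maximally_monotone A \<longleftrightarrow> monotone_op A \<and>
     (\<forall>x u. (\<forall>y v. v \<in> A y \<longrightarrow> 0 \<le> (x - y) \<bullet> (u - v)) \<longrightarrow> u \<in> A x)"
proof (intro iffI conjI allI impI)
  assume mm: "maximally_monotone A"
  then show mono: "monotone_op A" by (simp add: maximally_monotone_def)
  fix x u assume *: "\<forall>y v. v \<in> A y \<longrightarrow> 0 \<le> (x - y) \<bullet> (u - v)"
  \<comment> \<open>Extending the graph by this single pair keeps it monotone, so maximality shows
    that the pair was already there.\<close>
  define B where "B = A(x := insert u (A x))"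
  have B: "gra B = insert (x, u) (gra A)"
    by (auto simp: B_def gra_def split: if_splits)
  have "0 \<le> (y - x) \<bullet> (v - u)" if "v \<in> A y" for y v
    using *[rule_format, OF that] by (simp add: inner_diff)
  then have "monotone_op B"
    using mono * unfolding monotone_op_def B by (auto simp: gra_def)
  then have "gra B = gra A"
    using mm B unfolding maximally_monotone_def by blast
  then show "u \<in> A x" using B by (auto simp: gra_def)
next
  assume *: "monotone_op A \<and>
     (\<forall>x u. (\<forall>y v. v \<in> A y \<longrightarrow> 0 \<le> (x - y) \<bullet> (u - v)) \<longrightarrow> u \<in> A x)"
  show "maximally_monotone A"
    unfolding maximally_monotone_def
  proof (intro conjI allI impI)
    show "monotone_op A" using * by simp
    fix B assume B: "monotone_op B \<and> gra A \<subseteq> gra B"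
    have "u \<in> A x" if u: "u \<in> B x" for x u
    proof -
      have "0 \<le> (x - y) \<bullet> (u - v)" if "v \<in> A y" for y v
      proof -
        have "(y, v) \<in> gra B" "(x, u) \<in> gra B" using B u that by (auto simp: gra_def)
        then show ?thesis using B unfolding monotone_op_def by blast
      qed
      then show ?thesis using * by blast
    qed
    then show "gra B = gra A" using B by (auto simp: gra_def)
  qed
qed

lemma maximally_monotoneD:
  assumes "maximally_monotone A" "u \<in> A x" "v \<in> A y"
  shows "0 \<le> (x - y) \<bullet> (u - v)"
proof -
  have "(x, u) \<in> gra A" "(y, v) \<in> gra A" using assms by (auto simp: gra_def)
  then show ?thesis using assms(1) unfolding maximally_monotone_def monotone_op_def by blast
qed

lemma maximally_monotone_mem:
  assumes "maximally_monotone A" "\<And>y v. v \<in> A y \<Longrightarrow> 0 \<le> (x - y) \<bullet> (u - v)"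
  shows "u \<in> A x"
  using assms unfolding maximally_monotone_iff by blast

text \<open>In its applications \<open>mid\<close> compares the infimum \<open>m\<close> with the
  value at the midpoint of \<open>s j\<close> and \<open>s k\<close>. Quadratic convexity leaves the
  distance term, which must vanish as \<open>\<phi>\<close> tends to \<open>m\<close>. Completeness
  then supplies the minimizers behind both Minty's theorem and the Riesz theorem.\<close>

lemma Cauchy_minimizing_sequence:
  fixes s :: "nat \<Rightarrow> 'b::metric_space"
  assumes lim: "\<phi> \<longlonglongrightarrow> (m::real)" and c: "c > 0"
    and mid: "\<And>j k. m \<le> (\<phi> j + \<phi> k) / 2 - c * (dist (s j) (s k))\<^sup>2"
  shows "Cauchy s"
proof (rule metric_CauchyI)
  fix e :: real assume e: "e > 0"
  then have "0 < c * e\<^sup>2" using c by simp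
  from LIMSEQ_D[OF lim this] obtain N where N: "\<And>n. n \<ge> N \<Longrightarrow> \<bar>\<phi> n - m\<bar> < c * e\<^sup>2" by auto
  have "dist (s j) (s k) < e" if "j \<ge> N" "k \<ge> N" for j k
  proof -
    have "c * (dist (s j) (s k))\<^sup>2 < c * e\<^sup>2"
      using mid[of j k] N[OF that(1)] N[OF that(2)] by (simp add: abs_if field_simps split: if_splits)
    then have "(dist (s j) (s k))\<^sup>2 < e\<^sup>2" using c by simp
    then show ?thesis using e by (simp add: power_less_imp_less_base)
  qed
  then show "\<exists>N. \<forall>j\<ge>N. \<forall>k\<ge>N. dist (s j) (s k) < e" by blast
qed

lemma norm_midpoint_square:
  fixes x y :: "'b::real_inner"
  shows "(norm ((1/2) *\<^sub>R (x + y)))\<^sup>2 = ((norm x)\<^sup>2 + (norm y)\<^sup>2) / 2 - (dist x y)\<^sup>2 / 4"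
proof -
  have "(norm ((1/2) *\<^sub>R (x + y)))\<^sup>2 = (norm (x + y))\<^sup>2 / 4"
    by (simp add: power_divide)
  then show ?thesis
    by (simp only: power2_norm_eq_inner dist_norm inner_add_left inner_add_right
        inner_diff_left inner_diff_right inner_commute[of y x]) (simp add: field_simps)
qed

text \<open>The first-order condition at a minimizer: \<open>a\<close> is a one-sided derivative
  along a segment, and dividing by \<open>s\<close> before letting \<open>s\<close> decrease to 0
  removes the quadratic remainder.\<close>

lemma nonneg_of_quadratic:
  fixes a b :: real
  assumes "\<And>s. 0 < s \<Longrightarrow> s < 1 \<Longrightarrow> 0 \<le> s * a + s\<^sup>2 * b"
  shows "0 \<le> a"
proof (rule tendsto_lowerbound)
  show "((\<lambda>s. a + s * b) \<longlongrightarrow> a) (at_right 0)"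
    by (auto intro!: tendsto_eq_intros)
  show "\<forall>\<^sub>F s in at_right 0. 0 \<le> a + s * b"
    unfolding eventually_at_right_field
  proof (intro exI[of _ 1] conjI allI impI)
    fix s :: real assume s: "0 < s" "s < 1"
    have "0 \<le> s * (a + s * b)" using assms[OF s] by (simp add: algebra_simps power2_eq_square)
    then show "0 \<le> a + s * b" using s by (simp add: zero_le_mult_iff)
  qed simp
qed simp

text \<open>Minty's theorem. The relation \<open>F z t\<close> is the epigraph of the Fitzpatrick function of \<open>A\<close>,
  which dominates the duality product and agrees with it on the graph. The first-order condition
  at the minimizer \<open>(x, u)\<close> of this function plus half the squared norm puts \<open>(-u, -x)\<close>
  into the graph and gives \<open>u = -x\<close>.\<close>

lemma maximally_monotone_minus_mem:
  fixes A :: "'h::{real_inner, complete_space} \<Rightarrow> 'h set"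
  assumes A: "maximally_monotone A"
  shows "\<exists>p. - p \<in> A p"
proof -
  define F :: "'h \<times> 'h \<Rightarrow> real \<Rightarrow> bool" where
    "F z t \<longleftrightarrow> (\<forall>y v. v \<in> A y \<longrightarrow> fst z \<bullet> v + y \<bullet> snd z - y \<bullet> v \<le> t)" for z t
  define S where "S = {t + (norm z)\<^sup>2 / 2 | z t. F z t}"
  \<comment> \<open>If \<open>z\<close> is monotonically related to the graph, maximality lets
    \<open>z\<close> itself serve as the test pair in \<open>F\<close>; otherwise a pair violating
    monotonicity does.\<close>
  have F_inner: "fst z \<bullet> snd z \<le> t" if "F z t" for z t
  proof (cases "\<forall>y v. v \<in> A y \<longrightarrow> 0 \<le> (fst z - y) \<bullet> (snd z - v)")
    case True
    then have "snd z \<in> A (fst z)" using maximally_monotone_mem[OF A] by blast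
    then have "fst z \<bullet> snd z + fst z \<bullet> snd z - fst z \<bullet> snd z \<le> t"
      using that unfolding F_def by blast
    then show ?thesis by simp
  next
    case False
    then obtain y v where v: "v \<in> A y" and neg: "(fst z - y) \<bullet> (snd z - v) < 0"
      by (auto simp: not_le)
    have "fst z \<bullet> v + y \<bullet> snd z - y \<bullet> v \<le> t"
      using that v unfolding F_def by blast
    then show ?thesis using neg by (simp add: inner_diff algebra_simps)
  qed
  have norm2: "(norm z)\<^sup>2 = (norm (fst z))\<^sup>2 + (norm (snd z))\<^sup>2" for z :: "'h \<times> 'h"
    by (cases z) (simp add: norm_prod_def)
  have S_nonneg: "0 \<le> t + (norm z)\<^sup>2 / 2" if "F z t" for z t
  proof -
    have "0 \<le> (norm (fst z + snd z))\<^sup>2 / 2" by simp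
    also have "\<dots> = fst z \<bullet> snd z + (norm z)\<^sup>2 / 2"
      unfolding norm2 by (simp add: power2_norm_eq_inner inner_add inner_commute field_simps)
    finally show ?thesis using F_inner[OF that] by simp
  qed
  have F_gra: "F (y, v) (y \<bullet> v)" if "v \<in> A y" for y v
    using maximally_monotoneD[OF A that] by (auto simp: F_def inner_diff algebra_simps)
  \<comment> \<open>With an empty graph every pair would be monotonically related to it, hence a
    member.\<close>
  have "\<exists>y v. v \<in> A y" using maximally_monotone_mem[OF A] by blast
  then have S_ne: "S \<noteq> {}" using F_gra unfolding S_def by blast
  have bdd: "bdd_below S" using S_nonneg by (auto simp: S_def intro!: bdd_belowI[of _ 0])
  define m where "m = Inf S"
  have m_le: "m \<le> t + (norm z)\<^sup>2 / 2" if "F z t" for z t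
    unfolding m_def using that by (intro cInf_lower[OF _ bdd]) (unfold S_def, blast)
  have "m \<in> closure S" unfolding m_def by (rule closure_contains_Inf[OF S_ne bdd])
  then obtain \<phi> where "\<And>n. \<phi> n \<in> S" and lim: "\<phi> \<longlonglongrightarrow> m"
    unfolding closure_sequential by blast
  then have "\<forall>n. \<exists>z t. \<phi> n = t + (norm z)\<^sup>2 / 2 \<and> F z t" unfolding S_def by blast
  then obtain z t where \<phi>: "\<And>n. \<phi> n = t n + (norm (z n))\<^sup>2 / 2" and F: "\<And>n. F (z n) (t n)"
    by metis
  have F_conv: "F ((1 - s) *\<^sub>R z1 + s *\<^sub>R z2) ((1 - s) * t1 + s * t2)"
    if "F z1 t1" "F z2 t2" "0 \<le> s" "s \<le> 1" for s z1 z2 t1 t2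
    unfolding F_def[of "_ + _"]
  proof (intro allI impI)
    fix y v assume "v \<in> A y"
    then have "fst z1 \<bullet> v + y \<bullet> snd z1 - y \<bullet> v \<le> t1" "fst z2 \<bullet> v + y \<bullet> snd z2 - y \<bullet> v \<le> t2"
      using that by (auto simp: F_def)
    from add_mono[OF mult_left_mono[OF this(1), of "1 - s"] mult_left_mono[OF this(2), of s]]
    show "fst ((1 - s) *\<^sub>R z1 + s *\<^sub>R z2) \<bullet> v + y \<bullet> snd ((1 - s) *\<^sub>R z1 + s *\<^sub>R z2) - y \<bullet> v
        \<le> (1 - s) * t1 + s * t2"
      using that by (simp add: inner_add algebra_simps)
  qed
  have "Cauchy z"
  \<comment> \<open>\<open>1/8\<close> is the \<open>1/4\<close> of the midpoint identity times the
    factor \<open>1/2\<close> of the squared norm.\<close>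
  proof (rule Cauchy_minimizing_sequence[OF lim, where c = "1/8"])
    fix j k
    have "m \<le> (t j + t k) / 2 + (norm ((1/2) *\<^sub>R (z j + z k)))\<^sup>2 / 2"
      using m_le[OF F_conv[OF F[of j] F[of k], of "1/2"]] by (simp add: scaleR_add_right add_divide_distrib)
    then show "m \<le> (\<phi> j + \<phi> k) / 2 - 1 / 8 * (dist (z j) (z k))\<^sup>2"
      unfolding norm_midpoint_square \<phi> by (simp add: field_simps)
  qed simp
  then obtain w where z_lim: "z \<longlonglongrightarrow> w"
    using Cauchy_convergent_iff convergent_def by blast
  \<comment> \<open>The epigraph values converge along with the points, since \<open>t n\<close> is
    \<open>\<phi> n\<close> minus half a squared norm; the conditions in \<open>F\<close> are closed
    and pass to the limit.\<close>
  define \<tau> where "\<tau> = m - (norm w)\<^sup>2 / 2"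
  have t_lim: "t \<longlonglongrightarrow> \<tau>"
  proof -
    have "(\<lambda>n. \<phi> n - (norm (z n))\<^sup>2 / 2) \<longlonglongrightarrow> m - (norm w)\<^sup>2 / 2"
      by (intro tendsto_intros lim z_lim) simp
    then show ?thesis by (simp add: \<phi> \<tau>_def)
  qed
  have F_w: "F w \<tau>"
    unfolding F_def
  proof (intro allI impI)
    fix y v assume "v \<in> A y"
    then have "fst (z n) \<bullet> v + y \<bullet> snd (z n) - y \<bullet> v \<le> t n" for n
      using F by (auto simp: F_def)
    moreover have "(\<lambda>n. fst (z n) \<bullet> v + y \<bullet> snd (z n) - y \<bullet> v) \<longlonglongrightarrow> fst w \<bullet> v + y \<bullet> snd w - y \<bullet> v"
      by (intro tendsto_intros z_lim)
    ultimately show "fst w \<bullet> v + y \<bullet> snd w - y \<bullet> v \<le> \<tau>"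
      using t_lim by (intro LIMSEQ_le[OF _ t_lim]) auto
  qed
  define x u where "x = fst w" and "u = snd w"
  have w: "w = (x, u)" by (simp add: x_def u_def)
  have key: "(norm (x + u))\<^sup>2 \<le> (- u - y) \<bullet> (- x - v)" if v: "v \<in> A y" for y v
  proof -
    \<comment> \<open>Minimality of \<open>(w, \<tau>)\<close> along the segment in the epigraph
      towards the graph point \<open>(y, v)\<close>, whose epigraph value is
      \<open>y \<bullet> v\<close>.\<close>
    have "0 \<le> (y \<bullet> v - \<tau>) + w \<bullet> ((y, v) - w)"
    proof (rule nonneg_of_quadratic)
      fix s :: real assume s: "0 < s" "s < 1"
      have eq: "(norm ((1 - s) *\<^sub>R w + s *\<^sub>R (y, v)))\<^sup>2
          = (norm w)\<^sup>2 + 2 * s * (w \<bullet> ((y, v) - w)) + s\<^sup>2 * (norm ((y, v) - w))\<^sup>2"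
        unfolding power2_norm_eq_inner
        by (simp only: inner_add_left inner_add_right inner_scaleR_left inner_scaleR_right
              inner_diff_left inner_diff_right inner_commute[of "(y, v)" w])
           (simp add: algebra_simps power2_eq_square)
      show "0 \<le> s * ((y \<bullet> v - \<tau>) + w \<bullet> ((y, v) - w)) + s\<^sup>2 * ((norm ((y, v) - w))\<^sup>2 / 2)"
        using m_le[OF F_conv[OF F_w F_gra[OF v], of s]] s unfolding eq
        by (simp add: \<tau>_def field_simps)
    qed
    moreover have "x \<bullet> u \<le> \<tau>" using F_inner[OF F_w] by (simp add: w)
    ultimately show ?thesis
      unfolding w by (simp add: power2_norm_eq_inner inner_add inner_diff inner_commute)
  qed
  have mem: "- x \<in> A (- u)"
    by (rule maximally_monotone_mem[OF A]) (rule order_trans[OF zero_le_power2 key])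
  \<comment> \<open>At the pair \<open>(- u, - x)\<close> the right side of \<open>key\<close> is
    0.\<close>
  from key[OF mem] have "x = - u" by (simp add: eq_neg_iff_add_eq_0)
  then show ?thesis using mem by (metis minus_minus)
qed

text \<open>Reduces surjectivity of \<open>Id + \<gamma> A\<close> to the preceding result: that
  \<open>- p\<close> lies in \<open>\<gamma> A p - u\<close> says that \<open>u\<close> lies in
  \<open>p + \<gamma> A p\<close>.\<close>

lemma maximally_monotone_scale_shift:
  fixes A :: "'h::real_inner \<Rightarrow> 'h set"
  assumes A: "maximally_monotone A" and \<gamma>: "\<gamma> > 0"
  shows "maximally_monotone (\<lambda>p. {\<gamma> *\<^sub>R v - u | v. v \<in> A p})"
  unfolding maximally_monotone_iff
proof (intro conjI allI impI)
  have "0 \<le> (x - y) \<bullet> (\<gamma> *\<^sub>R a - u - (\<gamma> *\<^sub>R b - u))" if "a \<in> A x" "b \<in> A y" for x y a b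
  proof -
    have "\<gamma> *\<^sub>R a - u - (\<gamma> *\<^sub>R b - u) = \<gamma> *\<^sub>R (a - b)" by (simp add: scaleR_right_diff_distrib)
    then show ?thesis using maximally_monotoneD[OF A that] \<gamma> by simp
  qed
  then show "monotone_op (\<lambda>p. {\<gamma> *\<^sub>R v - u | v. v \<in> A p})"
    by (auto simp: monotone_op_def gra_def)
next
  fix x w assume *: "\<forall>y v. v \<in> {\<gamma> *\<^sub>R v - u | v. v \<in> A y} \<longrightarrow> 0 \<le> (x - y) \<bullet> (w - v)"
  have "(1 / \<gamma>) *\<^sub>R (w + u) \<in> A x"
  proof (rule maximally_monotone_mem[OF A])
    fix y v assume "v \<in> A y"
    then have "0 \<le> (x - y) \<bullet> (w - (\<gamma> *\<^sub>R v - u))" using * by blast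
    also have "w - (\<gamma> *\<^sub>R v - u) = \<gamma> *\<^sub>R ((1 / \<gamma>) *\<^sub>R (w + u) - v)"
      using \<gamma> by (simp add: algebra_simps)
    finally show "0 \<le> (x - y) \<bullet> ((1 / \<gamma>) *\<^sub>R (w + u) - v)"
      using \<gamma> by (simp add: zero_le_mult_iff)
  qed
  then show "w \<in> {\<gamma> *\<^sub>R v - u | v. v \<in> A x}"
    using \<gamma> by (intro CollectI exI[of _ "(1 / \<gamma>) *\<^sub>R (w + u)"]) auto
qed

text \<open>Monotonicity makes the preimage of \<open>u\<close> unique, since the squared distance
  of two candidates is a nonpositive multiple of a monotonicity product. Only here is
  \<open>the_elem\<close> unfolded.\<close>

lemma resolvent_eqI:
  fixes A :: "'h::real_inner \<Rightarrow> 'h set"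
  assumes A: "maximally_monotone A" and \<gamma>: "\<gamma> > 0" and v: "v \<in> A p" and u: "u = p + \<gamma> *\<^sub>R v"
  shows "resolvent \<gamma> A u = p"
proof -
  have "q = p" if "u \<in> id_plus_scaled \<gamma> A q" for q
  proof -
    from that obtain w where w: "w \<in> A q" "u = q + \<gamma> *\<^sub>R w" by (auto simp: id_plus_scaled_def)
    have "q - p = \<gamma> *\<^sub>R (v - w)" using u w(2) by (simp add: algebra_simps)
    then have "(norm (q - p))\<^sup>2 = - (\<gamma> * ((q - p) \<bullet> (w - v)))"
      unfolding power2_norm_eq_inner by (simp add: inner_diff_right right_diff_distrib)
    also have "\<dots> \<le> 0" using maximally_monotoneD[OF A w(1) v] \<gamma> by simp
    finally show ?thesis by simp
  qed
  moreover have "u \<in> id_plus_scaled \<gamma> A p" using u v by (auto simp: id_plus_scaled_def)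
  ultimately have "inverse_op (id_plus_scaled \<gamma> A) u = {p}" unfolding inverse_op_def by blast
  then show ?thesis by (simp add: resolvent_def)
qed

section \<open>Inequalities for a single resolvent step\<close>

context
  fixes A :: "'h::{real_inner, complete_space} \<Rightarrow> 'h set" and \<gamma> :: real
  assumes A: "maximally_monotone A" and \<gamma>: "\<gamma> > 0"
begin

lemma resolvent_mem: "(1 / \<gamma>) *\<^sub>R (u - resolvent \<gamma> A u) \<in> A (resolvent \<gamma> A u)"
proof -
  obtain p v where v: "v \<in> A p" and p: "- p = \<gamma> *\<^sub>R v - u"
    using maximally_monotone_minus_mem[OF maximally_monotone_scale_shift[OF A \<gamma>, of u]] by blast
  then have u: "u = p + \<gamma> *\<^sub>R v" by (simp add: algebra_simps)
  have "resolvent \<gamma> A u = p" by (rule resolvent_eqI[OF A \<gamma> v u])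
  then show ?thesis using v u \<gamma> by simp
qed

lemma resolvent_zer:
  assumes "z \<in> zer A"
  shows "resolvent \<gamma> A z = z"
  using assms by (intro resolvent_eqI[OF A \<gamma>, of 0]) (auto simp: zer_def)

text \<open>Monotonicity of \<open>A\<close> at the graph points given by
  \<open>resolvent_mem\<close>, cleared of the factor \<open>1 / \<gamma>\<close>. The later
  estimates expand this inner product.\<close>

lemma resolvent_firmly_nonexpansive:
  "0 \<le> (resolvent \<gamma> A u - resolvent \<gamma> A w) \<bullet> ((u - resolvent \<gamma> A u) - (w - resolvent \<gamma> A w))"
proof -
  define a b where "a = u - resolvent \<gamma> A u" and "b = w - resolvent \<gamma> A w"
  have "0 \<le> (resolvent \<gamma> A u - resolvent \<gamma> A w) \<bullet> ((1 / \<gamma>) *\<^sub>R a - (1 / \<gamma>) *\<^sub>R b)"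
    unfolding a_def b_def by (rule maximally_monotoneD[OF A resolvent_mem resolvent_mem])
  also have "(1 / \<gamma>) *\<^sub>R a - (1 / \<gamma>) *\<^sub>R b = (1 / \<gamma>) *\<^sub>R (a - b)"
    by (rule scaleR_right_diff_distrib[symmetric])
  finally show ?thesis using \<gamma> by (simp add: zero_le_divide_iff flip: a_def b_def)
qed

lemma resolvent_nonexpansive: "norm (resolvent \<gamma> A u - resolvent \<gamma> A w) \<le> norm (u - w)"
proof -
  define p where "p = resolvent \<gamma> A u - resolvent \<gamma> A w"
  have "(u - resolvent \<gamma> A u) - (w - resolvent \<gamma> A w) = (u - w) - p"
    by (simp add: p_def)
  then have "0 \<le> p \<bullet> ((u - w) - p)"
    using resolvent_firmly_nonexpansive[of u w] by (simp only: p_def)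
  then have "(norm p)\<^sup>2 \<le> p \<bullet> (u - w)"
    by (simp add: power2_norm_eq_inner inner_diff_right)
  also have "\<dots> \<le> norm p * norm (u - w)" by (rule norm_cauchy_schwarz)
  finally show ?thesis
    unfolding p_def[symmetric] by (cases "norm p = 0") (auto simp: power2_eq_square)
qed

text \<open>Split \<open>u - z\<close> at the resolvent of \<open>u\<close>: the two pieces have a
  nonnegative inner product. Bounds on distances to a zero thereby become bounds on
  residuals.\<close>

lemma resolvent_residual_le:
  assumes "z \<in> zer A"
  shows "norm (resolvent \<gamma> A u - u) \<le> norm (u - z)"
proof -
  have "0 \<le> (resolvent \<gamma> A u - z) \<bullet> (u - resolvent \<gamma> A u)"
    using resolvent_firmly_nonexpansive[of u z] by (simp add: resolvent_zer[OF assms])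
  moreover have "(norm (u - z))\<^sup>2 = (norm (resolvent \<gamma> A u - u))\<^sup>2 + (norm (resolvent \<gamma> A u - z))\<^sup>2
      + 2 * ((resolvent \<gamma> A u - z) \<bullet> (u - resolvent \<gamma> A u))"
    by (simp add: power2_norm_eq_inner inner_diff_left inner_diff_right inner_commute)
  ultimately have "(norm (resolvent \<gamma> A u - u))\<^sup>2 \<le> (norm (u - z))\<^sup>2"
    by (smt (verit) zero_le_power2)
  then show ?thesis by (rule power2_le_imp_le) simp
qed

text \<open>Firm nonexpansiveness bounds \<open>(u - z) \<bullet> r\<close> by minus the squared
  residual. The cross term then contributes \<open>- 2 * l\<close> and the squared step
  \<open>l * l\<close>, together \<open>- l * (2 - l)\<close>.\<close>

lemma relaxed_resolvent_dist:
  assumes "z \<in> zer A" "l \<ge> 0"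
  shows "(norm (u + l *\<^sub>R (resolvent \<gamma> A u - u) - z))\<^sup>2
    \<le> (norm (u - z))\<^sup>2 - l * (2 - l) * (norm (resolvent \<gamma> A u - u))\<^sup>2"
proof -
  define r where "r = resolvent \<gamma> A u - u"
  have "0 \<le> (resolvent \<gamma> A u - z) \<bullet> (u - resolvent \<gamma> A u)"
    using resolvent_firmly_nonexpansive[of u z] by (simp add: resolvent_zer[OF assms(1)])
  also have "\<dots> = (r + (u - z)) \<bullet> (- r)" by (simp add: r_def)
  finally have "(u - z) \<bullet> r \<le> - (norm r)\<^sup>2"
    unfolding power2_norm_eq_inner inner_add_left inner_minus_right by linarith
  from mult_left_mono[OF this, of "2 * l"] have "2 * l * ((u - z) \<bullet> r) \<le> - (2 * l * (norm r)\<^sup>2)"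
    using assms(2) by simp
  moreover have "(norm ((u - z) + l *\<^sub>R r))\<^sup>2
      = (norm (u - z))\<^sup>2 + 2 * l * ((u - z) \<bullet> r) + l * l * (norm r)\<^sup>2"
    unfolding power2_norm_eq_inner
    by (simp add: inner_add_left inner_add_right inner_commute[of r "u - z"] distrib_left)
  moreover have eq: "u + l *\<^sub>R r - z = (u - z) + l *\<^sub>R r" by simp
  moreover have "l * (2 - l) * (norm r)\<^sup>2 = 2 * l * (norm r)\<^sup>2 - l * l * (norm r)\<^sup>2"
    by (simp add: left_diff_distrib right_diff_distrib)
  ultimately show ?thesis
    unfolding r_def[symmetric] eq by linarith
qed

text \<open>The squared bound weighs the error with the distance of the new point: squaring |w - z|
  - l |e| \<le> |y - z|, with \<open>y\<close> the error-free step, leaves a term linear in the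
  error and no separate square of it.\<close>

lemma relaxed_inexact_resolvent_dist:
  assumes z: "z \<in> zer A" and l: "0 \<le> l" "l \<le> 2"
    and w: "w = u + l *\<^sub>R (resolvent \<gamma> A u - e - u)"
  shows "norm (w - z) \<le> norm (u - z) + l * norm e"
    and "(norm (w - z))\<^sup>2 \<le> (norm (u - z))\<^sup>2
      - l * (2 - l) * (norm (resolvent \<gamma> A u - u))\<^sup>2 + 2 * norm (w - z) * (l * norm e)"
proof -
  define y where "y = u + l *\<^sub>R (resolvent \<gamma> A u - u)"
  have y: "(norm (y - z))\<^sup>2 \<le> (norm (u - z))\<^sup>2 - l * (2 - l) * (norm (resolvent \<gamma> A u - u))\<^sup>2"
    unfolding y_def by (rule relaxed_resolvent_dist[OF z l(1)])
  moreover have "0 \<le> l * (2 - l) * (norm (resolvent \<gamma> A u - u))\<^sup>2" using l by simp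
  ultimately have "(norm (y - z))\<^sup>2 \<le> (norm (u - z))\<^sup>2" by linarith
  then have y_le: "norm (y - z) \<le> norm (u - z)" by (rule power2_le_imp_le) simp
  have "w - z = (y - z) - l *\<^sub>R e" by (simp add: w y_def algebra_simps)
  then have "norm (w - z) \<le> norm (y - z) + norm (l *\<^sub>R e)"
    using norm_triangle_ineq4[of "y - z" "l *\<^sub>R e"] by (simp only:)
  then have le: "norm (w - z) \<le> norm (y - z) + l * norm e"
    using l by simp
  then show "norm (w - z) \<le> norm (u - z) + l * norm e" using y_le by simp
  have "(norm (w - z))\<^sup>2 \<le> (norm (y - z))\<^sup>2 + 2 * norm (w - z) * (l * norm e)"
  \<comment> \<open>If the error exceeds the new distance, that inequality cannot be squared, but
    the error term alone already dominates.\<close>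
  proof (cases "l * norm e \<le> norm (w - z)")
    case True
    then have "(norm (w - z) - l * norm e)\<^sup>2 \<le> (norm (y - z))\<^sup>2"
      using le by (intro power_mono) auto
    moreover have "0 \<le> (l * norm e)\<^sup>2" by simp
    ultimately show ?thesis unfolding power2_diff by linarith
  next
    case False
    then have "norm (w - z) * norm (w - z) \<le> norm (w - z) * (l * norm e)"
      by (intro mult_left_mono) auto
    moreover have "0 \<le> norm (w - z) * (l * norm e)" using l by simp
    moreover have "0 \<le> (norm (y - z))\<^sup>2" by simp
    ultimately show ?thesis unfolding power2_eq_square[of "norm (w - z)"] by linarith
  qed
  then show "(norm (w - z))\<^sup>2 \<le> (norm (u - z))\<^sup>2
      - l * (2 - l) * (norm (resolvent \<gamma> A u - u))\<^sup>2 + 2 * norm (w - z) * (l * norm e)"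
    using y by linarith
qed

text \<open>Nonexpansiveness of the reflection \<open>2 J - Id\<close> makes the fixed-point residual decrease up to
  the errors.\<close>

lemma resolvent_residual_step:
  assumes l: "0 \<le> l" "l \<le> 2"
    and w: "w = u + l *\<^sub>R (resolvent \<gamma> A u - e - u)"
  shows "norm (resolvent \<gamma> A w - w) \<le> norm (resolvent \<gamma> A u - u) + l * norm e"
proof -
  define \<rho> d c where "\<rho> = resolvent \<gamma> A u - u" and "d = resolvent \<gamma> A w - resolvent \<gamma> A u"
    and "c = w - u"
  have "(w - resolvent \<gamma> A w) - (u - resolvent \<gamma> A u) = c - d" by (simp add: c_def d_def)
  then have "0 \<le> d \<bullet> (c - d)"
    using resolvent_firmly_nonexpansive[of w u] by (simp only: d_def)
  \<comment> \<open>\<open>2 *\<^sub>R d - c\<close> is the increment of the reflection from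
    \<open>u\<close> to \<open>w\<close>.\<close>
  then have "(norm (2 *\<^sub>R d - c))\<^sup>2 \<le> (norm c)\<^sup>2"
    unfolding power2_norm_eq_inner
    by (simp add: inner_diff_left inner_diff_right inner_commute[of c d])
  then have "norm (2 *\<^sub>R d - c) \<le> norm c" by (rule power2_le_imp_le) simp
  also have "c = l *\<^sub>R \<rho> - l *\<^sub>R e" by (simp add: c_def w \<rho>_def algebra_simps)
  then have "norm c \<le> l * norm \<rho> + l * norm e"
    using norm_triangle_ineq4[of "l *\<^sub>R \<rho>" "l *\<^sub>R e"] l by simp
  finally have 1: "norm (2 *\<^sub>R d - c) \<le> l * norm \<rho> + l * norm e" .
  have 2: "norm ((2 - l) *\<^sub>R \<rho> + l *\<^sub>R e) \<le> (2 - l) * norm \<rho> + l * norm e"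
    using norm_triangle_ineq[of "(2 - l) *\<^sub>R \<rho>" "l *\<^sub>R e"] l by simp
  have "(2 - l) *\<^sub>R \<rho> + l *\<^sub>R e = 2 *\<^sub>R \<rho> - c"
    by (simp add: \<open>c = l *\<^sub>R \<rho> - l *\<^sub>R e\<close> scaleR_diff_left)
  \<comment> \<open>The new residual vector is the mean of two vectors whose bounds weigh
    \<open>norm \<rho>\<close> with \<open>l\<close> and \<open>2 - l\<close>. The weights add up to
    2, so the old residual enters with factor 1.\<close>
  moreover have "2 *\<^sub>R (resolvent \<gamma> A w - w) = (2 *\<^sub>R d - c) + (2 *\<^sub>R \<rho> - c)"
    by (simp add: d_def c_def \<rho>_def algebra_simps scaleR_2)
  ultimately have "norm (2 *\<^sub>R (resolvent \<gamma> A w - w)) \<le> 2 * norm \<rho> + 2 * (l * norm e)"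
    using norm_triangle_ineq[of "2 *\<^sub>R d - c" "2 *\<^sub>R \<rho> - c"] 1 2 by (simp add: left_diff_distrib)
  then show ?thesis by (simp add: \<rho>_def)
qed

end

section \<open>Weak convergence\<close>

text \<open>The representing vector is the minimizer of half the squared norm minus
  \<open>f\<close>. The first-order condition in the directions \<open>y\<close> and
  \<open>- y\<close> gives the equality.\<close>

lemma riesz_representation_inner:
  fixes f :: "'h::{real_inner, complete_space} \<Rightarrow> real"
  assumes f: "bounded_linear f"
  shows "\<exists>w. \<forall>y. f y = w \<bullet> y"
proof -
  interpret f: bounded_linear f by fact
  define g where "g v = (norm v)\<^sup>2 / 2 - f v" for v
  obtain K where K: "\<And>v. norm (f v) \<le> norm v * K" using f.bounded by blast
  have "- (K\<^sup>2 / 2) \<le> g v" for v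
  proof -
    have "0 \<le> (norm v - K)\<^sup>2" by simp
    moreover have "f v \<le> norm v * K" using K[of v] by simp
    ultimately show ?thesis by (simp add: g_def power2_diff)
  qed
  then have bdd: "bdd_below (range g)" by (intro bdd_belowI) auto
  define m where "m = Inf (range g)"
  have m_le: "m \<le> g v" for v unfolding m_def by (rule cInf_lower[OF _ bdd]) simp
  have "m \<in> closure (range g)" unfolding m_def by (rule closure_contains_Inf[OF _ bdd]) simp
  then obtain \<phi> where "\<And>n. \<phi> n \<in> range g" and \<phi>: "\<phi> \<longlonglongrightarrow> m"
    unfolding closure_sequential by blast
  then have "\<forall>n. \<exists>v. \<phi> n = g v" by blast
  then obtain s where "\<And>n. \<phi> n = g (s n)" by metis
  then have "\<phi> = (\<lambda>n. g (s n))" by (rule ext)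
  then have lim: "(\<lambda>n. g (s n)) \<longlonglongrightarrow> m" using \<phi> by simp
  have "Cauchy s"
  proof (rule Cauchy_minimizing_sequence[OF lim, where c = "1/8"])
    fix j k
    have "m \<le> g ((1/2) *\<^sub>R (s j + s k))" by (rule m_le)
    also have "\<dots> = (g (s j) + g (s k)) / 2 - 1 / 8 * (dist (s j) (s k))\<^sup>2"
      unfolding g_def norm_midpoint_square f.scaleR f.add by (simp add: field_simps)
    finally show "m \<le> (g (s j) + g (s k)) / 2 - 1 / 8 * (dist (s j) (s k))\<^sup>2" .
  qed simp
  then obtain w where w: "s \<longlonglongrightarrow> w"
    using Cauchy_convergent_iff convergent_def by blast
  have "(\<lambda>n. g (s n)) \<longlonglongrightarrow> g w"
    unfolding g_def by (intro tendsto_intros f.tendsto w) simp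
  then have gw: "g w = m" using lim LIMSEQ_unique by blast
  have ge: "0 \<le> w \<bullet> y - f y" for y
  proof (rule nonneg_of_quadratic)
    fix r :: real
    have "m \<le> g (w + r *\<^sub>R y)" by (rule m_le)
    also have "\<dots> = g w + (r * (w \<bullet> y - f y) + r\<^sup>2 * ((norm y)\<^sup>2 / 2))"
      unfolding g_def power2_norm_eq_inner f.scaleR f.add
      by (simp add: inner_add_left inner_add_right inner_commute[of y w] field_simps power2_eq_square)
    finally show "0 \<le> r * (w \<bullet> y - f y) + r\<^sup>2 * ((norm y)\<^sup>2 / 2)" using gw by simp
  qed
  have "f y = w \<bullet> y" for y using ge[of y] ge[of "- y"] by (simp add: f.neg)
  then show ?thesis by blast
qed

lemma weakly_converges_subseq:
  assumes "weakly_converges x l" "strict_mono r"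
  shows "weakly_converges (x \<circ> r) l"
  unfolding weakly_converges_def
proof
  fix y
  have "((\<lambda>n. x n \<bullet> y) \<circ> r) \<longlonglongrightarrow> l \<bullet> y"
    using assms by (intro LIMSEQ_subseq_LIMSEQ) (auto simp: weakly_converges_def)
  then show "(\<lambda>n. (x \<circ> r) n \<bullet> y) \<longlonglongrightarrow> l \<bullet> y" by (simp add: o_def)
qed

lemma weakly_converges_diff:
  assumes "weakly_converges x l" "weakly_converges y k"
  shows "weakly_converges (\<lambda>n. x n - y n) (l - k)"
  using assms by (auto simp: weakly_converges_def inner_diff_left intro: tendsto_diff)

text \<open>Test the weak limit against itself and apply Cauchy-Schwarz.\<close>

lemma weakly_converges_norm_le:
  assumes x: "weakly_converges x l" and le: "\<And>n. norm (x n) \<le> c"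
  shows "norm l \<le> c"
proof -
  have c: "0 \<le> c" using order_trans[OF norm_ge_zero le] .
  have "l \<bullet> l \<le> c * norm l"
  proof (rule LIMSEQ_le_const2)
    show "(\<lambda>n. x n \<bullet> l) \<longlonglongrightarrow> l \<bullet> l" using x by (simp add: weakly_converges_def)
    have "x n \<bullet> l \<le> c * norm l" for n
      using norm_cauchy_schwarz[of "x n" l] mult_right_mono[OF le[of n] norm_ge_zero[of l]] by simp
    then show "\<exists>N. \<forall>n\<ge>N. x n \<bullet> l \<le> c * norm l" by blast
  qed
  then have "norm l * norm l \<le> c * norm l"
    by (simp add: power2_norm_eq_inner flip: power2_eq_square)
  then show ?thesis using c by (cases "l = 0") auto
qed

lemma bounded_real_convergent_subseq:
  fixes f :: "nat \<Rightarrow> real"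
  assumes "\<And>n. \<bar>f n\<bar> \<le> K"
  shows "\<exists>r. strict_mono r \<and> convergent (f \<circ> r)"
proof -
  have "bounded (range f)" using assms by (auto simp: bounded_iff)
  then show ?thesis using bounded_imp_convergent_subsequence[of f]
    by (auto simp: convergent_def)
qed

text \<open>A diagonal argument gives convergence against a countable dense set, boundedness extends
  it to all vectors, and the Riesz theorem turns the limit functional into a vector.\<close>

lemma bounded_weakly_convergent_subseq:
  fixes x :: "nat \<Rightarrow> 'h::{real_inner, polish_space}"
  assumes K: "\<And>n. norm (x n) \<le> K"
  shows "\<exists>r l. strict_mono r \<and> weakly_converges (x \<circ> r) l"
proof -
  have K0: "0 \<le> K" using order_trans[OF norm_ge_zero K] .
  have inner_le: "\<bar>x n \<bullet> y\<bar> \<le> K * norm y" for n y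
    using Cauchy_Schwarz_ineq2[of "x n" y] mult_right_mono[OF K[of n] norm_ge_zero[of y]] by simp
  obtain D :: "'h set" where D: "countable D" "\<And>X. open X \<Longrightarrow> X \<noteq> {} \<Longrightarrow> \<exists>d\<in>D. d \<in> X"
    by (rule countable_dense_setE) blast
  have D_ne: "D \<noteq> {}" using D(2)[of UNIV] by auto
  define d where "d = from_nat_into D"
  have d: "range d = D" unfolding d_def by (rule range_from_nat_into[OF D_ne D(1)])
  interpret subseqs "\<lambda>k s. convergent (\<lambda>n. x (s n) \<bullet> d k)"
  proof
    fix k and s :: "nat \<Rightarrow> nat" assume "strict_mono s"
    have "\<exists>r'. strict_mono r' \<and> convergent ((\<lambda>n. x (s n) \<bullet> d k) \<circ> r')"
      by (rule bounded_real_convergent_subseq) (rule inner_le)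
    then show "\<exists>r'. strict_mono r' \<and> convergent (\<lambda>n. x ((s \<circ> r') n) \<bullet> d k)"
      by (simp add: o_def)
  qed
  define r where "r = diagseq"
  have r: "strict_mono r" unfolding r_def by (rule subseq_diagseq)
  have conv_D: "convergent (\<lambda>n. x (r n) \<bullet> d k)" for k
  proof -
    \<comment> \<open>Only its tail from index \<open>Suc k\<close> on is used as a subsequence of
      the stage that settles \<open>d k\<close>.\<close>
    have "convergent (\<lambda>n. x ((diagseq \<circ> (+) (Suc k)) n) \<bullet> d k)"
    proof (rule diagseq_holds)
      fix q s :: "nat \<Rightarrow> nat" and n
      assume "strict_mono q" "convergent (\<lambda>i. x (s i) \<bullet> d n)"
      then show "convergent (\<lambda>i. x ((s \<circ> q) i) \<bullet> d n)"
        using convergent_subseq_convergent[of "\<lambda>i. x (s i) \<bullet> d n" q] by (simp add: o_def)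
    qed
    then have "convergent (\<lambda>n. x (r (n + Suc k)) \<bullet> d k)" by (simp add: r_def o_def add.commute)
    then show ?thesis using convergent_ignore_initial_segment[of "\<lambda>n. x (r n) \<bullet> d k"] by blast
  qed
  have conv: "convergent (\<lambda>n. x (r n) \<bullet> y)" for y
  proof -
    have "Cauchy (\<lambda>n. x (r n) \<bullet> y)"
    proof (rule CauchyI)
      fix e :: real assume e: "0 < e"
      \<comment> \<open>Dividing by \<open>K + 1\<close> rather than \<open>K\<close> covers
        \<open>K = 0\<close>. Each of the three terms of the triangle inequality is at most
        \<open>e / 4\<close>.\<close>
      define \<delta> where "\<delta> = e / 4 / (K + 1)"
      have \<delta>: "0 < \<delta>" using e K0 by (simp add: \<delta>_def)
      have K\<delta>: "K * \<delta> \<le> e / 4"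
      proof -
        have "K * \<delta> \<le> (K + 1) * \<delta>" using \<delta> by (intro mult_right_mono) auto
        also have "\<dots> = e / 4" using K0 nonzero_mult_div_cancel_left[of "K + 1" "e / 4"] by (simp add: \<delta>_def)
        finally show ?thesis .
      qed
      obtain k where k: "dist y (d k) < \<delta>"
        using D(2)[of "ball y \<delta>"] \<delta> d by fastforce
      have close: "\<bar>x n \<bullet> y - x n \<bullet> d k\<bar> \<le> e / 4" for n
      proof -
        have "\<bar>x n \<bullet> y - x n \<bullet> d k\<bar> \<le> K * norm (y - d k)"
          using inner_le[of n "y - d k"] by (simp add: inner_diff_right)
        also have "\<dots> \<le> K * \<delta>" using k K0 by (intro mult_left_mono) (auto simp: dist_norm)
        finally show ?thesis using K\<delta> by simp
      qed
      obtain N where N: "\<And>m n. m \<ge> N \<Longrightarrow> n \<ge> N \<Longrightarrow> norm (x (r m) \<bullet> d k - x (r n) \<bullet> d k) < e / 4"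
        using CauchyD[OF convergent_Cauchy[OF conv_D[of k]], of "e / 4"] e by auto
      have "norm (x (r m) \<bullet> y - x (r n) \<bullet> y) < e" if "m \<ge> N" "n \<ge> N" for m n
        using close[of "r m"] close[of "r n"] N[OF that] e by (simp add: abs_if split: if_splits)
      then show "\<exists>M. \<forall>m\<ge>M. \<forall>n\<ge>M. norm (x (r m) \<bullet> y - x (r n) \<bullet> y) < e" by blast
    qed
    then show ?thesis by (simp add: Cauchy_convergent_iff)
  qed
  define f where "f y = lim (\<lambda>n. x (r n) \<bullet> y)" for y
  have f: "(\<lambda>n. x (r n) \<bullet> y) \<longlonglongrightarrow> f y" for y
    using conv unfolding f_def by (simp add: convergent_LIMSEQ_iff)
  have "bounded_linear f"
  proof (rule bounded_linear_intro)
    show "f (a + b) = f a + f b" for a b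
      using LIMSEQ_unique[OF f[of "a + b"]] tendsto_add[OF f[of a] f[of b]] by (simp add: inner_add_right)
    show "f (c *\<^sub>R a) = c *\<^sub>R f a" for c a
      using LIMSEQ_unique[OF f[of "c *\<^sub>R a"]] tendsto_mult_left[OF f[of a], of c] by simp
    show "norm (f y) \<le> norm y * K" for y
    proof (rule LIMSEQ_le_const2[OF tendsto_norm[OF f]])
      show "\<exists>N. \<forall>n\<ge>N. norm (x (r n) \<bullet> y) \<le> norm y * K"
        using inner_le by (auto simp: mult.commute)
    qed
  qed
  then obtain l where "\<And>y. f y = l \<bullet> y" using riesz_representation_inner by blast
  then have "weakly_converges (x \<circ> r) l" using f by (simp add: weakly_converges_def)
  then show ?thesis using r by blast
qed

text \<open>Two weak cluster points \<open>l\<close> and \<open>l'\<close> agree: the difference of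
  the squared distances to them converges and is, up to a constant,
  \<open>2 * (x n \<bullet> (l - l'))\<close>, so both have the same inner product with
  \<open>l - l'\<close>.\<close>

lemma opial_weakly_converges:
  fixes x :: "nat \<Rightarrow> 'h::{real_inner, polish_space}"
  assumes dist: "\<And>z. z \<in> C \<Longrightarrow> convergent (\<lambda>n. norm (x n - z))"
    and ne: "C \<noteq> {}"
    and cluster: "\<And>r l. strict_mono r \<Longrightarrow> weakly_converges (x \<circ> r) l \<Longrightarrow> l \<in> C"
  shows "\<exists>l\<in>C. weakly_converges x l"
proof -
  obtain z where z: "z \<in> C" using ne by blast
  obtain B where B: "\<And>n. norm (norm (x n - z)) \<le> B"
    using convergent_imp_Bseq[OF dist[OF z]] by (auto simp: Bseq_def)
  define K where "K = B + norm z"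
  have K: "norm (x n) \<le> K" for n
    using B[of n] norm_triangle_ineq[of "x n - z" z] by (simp add: K_def)
  have unique: "l = l'"
    if r: "strict_mono r" "weakly_converges (x \<circ> r) l"
      and r': "strict_mono r'" "weakly_converges (x \<circ> r') l'" for r r' l l'
  proof -
    obtain L1 L2 where "(\<lambda>n. norm (x n - l')) \<longlonglongrightarrow> L1" "(\<lambda>n. norm (x n - l)) \<longlonglongrightarrow> L2"
      using dist[OF cluster[OF r]] dist[OF cluster[OF r']] unfolding convergent_def by blast
    then have "(\<lambda>n. ((norm (x n - l'))\<^sup>2 - (norm (x n - l))\<^sup>2 - (l' \<bullet> l' - l \<bullet> l)) / 2)
        \<longlonglongrightarrow> (L1\<^sup>2 - L2\<^sup>2 - (l' \<bullet> l' - l \<bullet> l)) / 2"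
      by (intro tendsto_intros) auto
    also have "(\<lambda>n. ((norm (x n - l'))\<^sup>2 - (norm (x n - l))\<^sup>2 - (l' \<bullet> l' - l \<bullet> l)) / 2)
        = (\<lambda>n. x n \<bullet> (l - l'))"
      unfolding power2_norm_eq_inner
      by (rule ext) (simp add: inner_diff_left inner_diff_right inner_commute field_simps)
    finally obtain L where L: "(\<lambda>n. x n \<bullet> (l - l')) \<longlonglongrightarrow> L" by blast
    have "l \<bullet> (l - l') = L"
      using LIMSEQ_subseq_LIMSEQ[OF L r(1)] r(2) LIMSEQ_unique
      unfolding weakly_converges_def o_def by blast
    moreover have "l' \<bullet> (l - l') = L"
      using LIMSEQ_subseq_LIMSEQ[OF L r'(1)] r'(2) LIMSEQ_unique
      unfolding weakly_converges_def o_def by blast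
    ultimately have "(l - l') \<bullet> (l - l') = 0" by (simp add: inner_diff_left)
    then show ?thesis by simp
  qed
  obtain r l where r: "strict_mono r" "weakly_converges (x \<circ> r) l"
    using bounded_weakly_convergent_subseq[of x K, OF K] by blast
  have "(\<lambda>n. x n \<bullet> y) \<longlonglongrightarrow> l \<bullet> y" for y
  \<comment> \<open>A subsequence staying away from the limit would contain a weakly convergent one,
    whose limit must again be \<open>l\<close>.\<close>
  proof (rule ccontr)
    assume "\<not> (\<lambda>n. x n \<bullet> y) \<longlonglongrightarrow> l \<bullet> y"
    then obtain e where e: "e > 0" "\<And>N. \<exists>n\<ge>N. e \<le> \<bar>x n \<bullet> y - l \<bullet> y\<bar>"
      by (auto simp: LIMSEQ_iff not_less)
    have "infinite {n. e \<le> \<bar>x n \<bullet> y - l \<bullet> y\<bar>}"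
      unfolding infinite_nat_iff_unbounded_le using e(2) by auto
    from infinite_enumerate[OF this] obtain s :: "nat \<Rightarrow> nat"
      where s: "strict_mono s" "\<And>n. e \<le> \<bar>x (s n) \<bullet> y - l \<bullet> y\<bar>" by blast
    obtain q l' where q: "strict_mono q" "weakly_converges ((x \<circ> s) \<circ> q) l'"
      using bounded_weakly_convergent_subseq[of "x \<circ> s" K] K by auto
    have "l = l'"
      using unique[OF r strict_mono_o[OF s(1) q(1)]] q(2) by (simp add: o_assoc)
    then have "(\<lambda>n. x (s (q n)) \<bullet> y) \<longlonglongrightarrow> l \<bullet> y"
      using q(2) by (simp add: weakly_converges_def)
    from LIMSEQ_D[OF this e(1)] obtain N where "\<bar>x (s (q N)) \<bullet> y - l \<bullet> y\<bar> < e" by auto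
    then show False using s(2)[of "q N"] by simp
  qed
  then have "weakly_converges x l" by (simp add: weakly_converges_def)
  then show ?thesis using cluster[OF r] by blast
qed

text \<open>Subtracting the partial sums of \<open>b\<close> makes \<open>a\<close> decreasing, and
  their boundedness keeps the difference bounded below.\<close>

lemma convergent_quasi_decreasing:
  fixes a b :: "nat \<Rightarrow> real"
  assumes a: "\<And>n. 0 \<le> a n" and le: "\<And>n. a (Suc n) \<le> a n + b n" and b: "summable b"
  shows "convergent a"
proof -
  define c where "c n = a n - (\<Sum>k<n. b k)" for n
  have s: "convergent (\<lambda>n. \<Sum>k<n. b k)" using b summable_iff_convergent by blast
  then obtain B where B: "\<And>n. norm (\<Sum>k<n. b k) \<le> B"
    using convergent_imp_Bseq[OF s] by (auto simp: Bseq_def)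
  have "decseq c" using le by (intro decseq_SucI) (simp add: c_def add.commute diff_le_eq)
  moreover have "- B \<le> c n" for n using a[of n] B[of n] by (simp add: c_def)
  ultimately obtain L where "c \<longlonglongrightarrow> L" using decseq_convergent by blast
  then have "convergent c" by (auto simp: convergent_def)
  then have "convergent (\<lambda>n. c n + (\<Sum>k<n. b k))" using s by (rule convergent_add)
  then show ?thesis by (simp add: c_def)
qed

text \<open>Opial's lemma combined with closedness of the graph under weak limits of points and
  strong limits of images. The images belong to \<open>p n\<close> instead of \<open>x n\<close>
  because a resolvent yields a graph point at its value; \<open>p\<close> inherits the weak cluster
  points of \<open>x\<close>.\<close>

lemma weakly_converges_zer:
  fixes A :: "'h::{real_inner, polish_space} \<Rightarrow> 'h set"
  assumes A: "maximally_monotone A" "zer A \<noteq> {}"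
    and fejer: "\<And>z n. z \<in> zer A \<Longrightarrow> norm (x (Suc n) - z) \<le> norm (x n - z) + b n"
    and b: "summable b"
    and u: "\<And>n. u n \<in> A (p n)" "u \<longlonglongrightarrow> 0" and p: "(\<lambda>n. x n - p n) \<longlonglongrightarrow> 0"
  shows "\<exists>l\<in>zer A. weakly_converges x l"
proof (rule opial_weakly_converges[OF _ A(2)])
  show conv: "convergent (\<lambda>n. norm (x n - z))" if "z \<in> zer A" for z
    using fejer[OF that] b by (intro convergent_quasi_decreasing) auto
  obtain z where z: "z \<in> zer A" using A(2) by blast
  have "Bseq (\<lambda>n. norm (x n - z))" by (rule convergent_imp_Bseq[OF conv[OF z]])
  then have "Bseq (\<lambda>n. x n - z)" by (simp add: Bseq_def)
  moreover have "Bseq (\<lambda>n. x n - p n)"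
    using convergent_imp_Bseq[of "\<lambda>n. norm (x n - p n)"] tendsto_norm[OF p]
    by (auto simp: Bseq_def convergent_def)
  ultimately obtain B1 B2 where B: "\<And>n. norm (x n - z) \<le> B1" "\<And>n. norm (x n - p n) \<le> B2"
    by (auto simp: Bseq_def)
  define K where "K = B1 + B2 + norm z"
  have K: "norm (p n) \<le> K" for n
    using B(1)[of n] B(2)[of n] norm_triangle_ineq[of "x n - z" z]
      norm_triangle_ineq4[of "x n" "x n - p n"] by (simp add: K_def)
  have pu: "(\<lambda>n. p n \<bullet> u n) \<longlonglongrightarrow> 0"
  proof (rule Lim_null_comparison)
    show "\<forall>\<^sub>F n in sequentially. norm (p n \<bullet> u n) \<le> K * norm (u n)"
    proof (intro always_eventually allI)
      show "norm (p n \<bullet> u n) \<le> K * norm (u n)" for n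
        using Cauchy_Schwarz_ineq2[of "p n" "u n"] mult_right_mono[OF K[of n] norm_ge_zero[of "u n"]]
        by simp
    qed
    show "(\<lambda>n. K * norm (u n)) \<longlonglongrightarrow> 0" using tendsto_mult_left[OF tendsto_norm[OF u(2)], of K] by simp
  qed
  fix r l assume r: "strict_mono r" "weakly_converges (x \<circ> r) l"
  have "0 \<in> A l"
  proof (rule maximally_monotone_mem[OF A(1)])
    fix y v assume v: "v \<in> A y"
    \<comment> \<open>Both factors of \<open>p (r n) \<bullet> u (r n)\<close> vary; it vanishes
      because \<open>p\<close> is bounded and \<open>u\<close> tends to 0 in norm. The limit is left
      unsimplified to match the limit rules.\<close>
    have "(\<lambda>n. (p (r n) - y) \<bullet> (u (r n) - v)) \<longlonglongrightarrow> 0 - l \<bullet> v + 0 \<bullet> v - (y \<bullet> 0 - y \<bullet> v)"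
    proof -
      have lims: "(\<lambda>n. x (r n) \<bullet> v) \<longlonglongrightarrow> l \<bullet> v" "(\<lambda>n. p (r n) \<bullet> u (r n)) \<longlonglongrightarrow> 0"
        "(\<lambda>n. (x (r n) - p (r n)) \<bullet> v) \<longlonglongrightarrow> 0 \<bullet> v" "(\<lambda>n. y \<bullet> u (r n)) \<longlonglongrightarrow> y \<bullet> 0"
        using r(2) LIMSEQ_subseq_LIMSEQ[OF pu r(1)]
          tendsto_inner[OF LIMSEQ_subseq_LIMSEQ[OF p r(1)] tendsto_const[of v]]
          tendsto_inner[OF tendsto_const[of y] LIMSEQ_subseq_LIMSEQ[OF u(2) r(1)]]
        unfolding weakly_converges_def o_def by blast+
      have "(\<lambda>n. p (r n) \<bullet> u (r n) - x (r n) \<bullet> v + (x (r n) - p (r n)) \<bullet> v - (y \<bullet> u (r n) - y \<bullet> v))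
          \<longlonglongrightarrow> 0 - l \<bullet> v + 0 \<bullet> v - (y \<bullet> 0 - y \<bullet> v)"
        by (intro tendsto_add tendsto_diff tendsto_const lims)
      then show ?thesis
        by (rule Lim_transform_eventually) (simp add: inner_diff_left inner_diff_right)
    qed
    moreover have "0 \<le> (p (r n) - y) \<bullet> (u (r n) - v)" for n
      using maximally_monotoneD[OF A(1) u(1) v] .
    ultimately have "0 \<le> 0 - l \<bullet> v + 0 \<bullet> v - (y \<bullet> 0 - y \<bullet> v)"
      by (intro LIMSEQ_le_const) auto
    then show "0 \<le> (l - y) \<bullet> (0 - v)" by (simp add: inner_diff_left)
  qed
  then show "l \<in> zer A" by (simp add: zer_def)
qed

section \<open>The proximal point algorithm\<close>

context
  fixes A :: "'h::{real_inner, polish_space} \<Rightarrow> 'h set"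
  assumes A: "maximally_monotone A" "zer A \<noteq> {}"
begin

text \<open>The elements \<open>u n\<close> of \<open>A (y (Suc n))\<close> have decreasing norms,
  and the Fejer inequality makes the squares of \<open>\<gamma> n * norm (u n)\<close> summable.
  Since the squares of \<open>\<gamma>\<close> are not, the norms can only decrease to 0.\<close>

lemma proximal_point_weakly_converges:
  assumes \<gamma>: "\<And>n. \<gamma> n > 0" "\<not> summable (\<lambda>n. (\<gamma> n)\<^sup>2)"
    and y: "\<And>n. y (Suc n) = resolvent (\<gamma> n) A (y n)"
  shows "\<exists>l\<in>zer A. weakly_converges y l"
proof -
  define u where "u n = (1 / \<gamma> n) *\<^sub>R (y n - y (Suc n))" for n
  have u_mem: "u n \<in> A (y (Suc n))" for n
    unfolding u_def y by (rule resolvent_mem[OF A(1) \<gamma>(1)])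
  have norm_diff: "norm (y n - y (Suc n)) = \<gamma> n * norm (u n)" for n
    using \<gamma>(1)[of n] by (simp add: u_def)
  have "norm (u (Suc n)) \<le> norm (u n)" for n
  proof -
    \<comment> \<open>The difference of consecutive points is a negative multiple of
      \<open>u (Suc n)\<close>, so monotonicity compares the two images.\<close>
    have "y (Suc (Suc n)) - y (Suc n) = - (\<gamma> (Suc n) *\<^sub>R u (Suc n))"
      using \<gamma>(1)[of "Suc n"] by (simp add: u_def)
    then have "0 \<le> - (\<gamma> (Suc n) * (u (Suc n) \<bullet> (u (Suc n) - u n)))"
      using maximally_monotoneD[OF A(1) u_mem[of "Suc n"] u_mem[of n]] by simp
    then have "u (Suc n) \<bullet> (u (Suc n) - u n) \<le> 0"
      using \<gamma>(1)[of "Suc n"] by (simp add: mult_le_0_iff)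
    then have "norm (u (Suc n)) * norm (u (Suc n)) \<le> u (Suc n) \<bullet> u n"
      by (simp add: inner_diff_right power2_norm_eq_inner flip: power2_eq_square)
    also have "\<dots> \<le> norm (u (Suc n)) * norm (u n)" by (rule norm_cauchy_schwarz)
    finally show ?thesis by (cases "u (Suc n) = 0") auto
  qed
  then have dec: "decseq (\<lambda>n. norm (u n))" by (rule decseq_SucI)
  obtain z where z: "z \<in> zer A" using A(2) by blast
  have step: "(norm (y (Suc n) - z))\<^sup>2 \<le> (norm (y n - z))\<^sup>2 - (norm (y n - y (Suc n)))\<^sup>2"
    if "z \<in> zer A" for z n
    using relaxed_resolvent_dist[OF A(1) \<gamma>(1)[of n] that, of 1 "y n"]
    by (simp add: norm_minus_commute flip: y)
  have "(\<Sum>n<N. (norm (y n - y (Suc n)))\<^sup>2) \<le> (norm (y 0 - z))\<^sup>2 - (norm (y N - z))\<^sup>2" for N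
  proof (induction N)
    case (Suc N)
    then show ?case using step[OF z, of N] by simp
  qed simp
  then have "(\<Sum>n<N. (norm (y n - y (Suc n)))\<^sup>2) \<le> (norm (y 0 - z))\<^sup>2" for N
    by (smt (verit) zero_le_power2)
  then have summ: "summable (\<lambda>n. (norm (y n - y (Suc n)))\<^sup>2)"
    by (intro summableI_nonneg_bounded) auto
  have p: "(\<lambda>n. y n - y (Suc n)) \<longlonglongrightarrow> 0"
  proof -
    have "(\<lambda>n. sqrt ((norm (y n - y (Suc n)))\<^sup>2)) \<longlonglongrightarrow> sqrt 0"
      by (intro tendsto_real_sqrt summable_LIMSEQ_zero summ)
    then show ?thesis by (simp add: tendsto_norm_zero_iff)
  qed
  obtain L where L: "(\<lambda>n. norm (u n)) \<longlonglongrightarrow> L" "\<And>n. L \<le> norm (u n)"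
    using decseq_convergent[OF dec, of 0] by auto
  have "L = 0"
  proof (rule ccontr)
    assume "L \<noteq> 0"
    moreover have "0 \<le> L" by (rule LIMSEQ_le_const[OF L(1)]) simp
    ultimately have L0: "0 < L" by simp
    have "(\<gamma> n)\<^sup>2 \<le> (norm (y n - y (Suc n)))\<^sup>2 / L\<^sup>2" for n
      using L0 L(2)[of n] \<gamma>(1)[of n]
      by (simp add: norm_diff power_mult_distrib pos_le_divide_eq mult_left_mono power_mono)
    then have "summable (\<lambda>n. (\<gamma> n)\<^sup>2)"
      by (intro summable_comparison_test'[OF summable_divide[OF summ, of "L\<^sup>2"]]) auto
    then show False using \<gamma>(2) by simp
  qed
  then have u0: "u \<longlonglongrightarrow> 0" using L(1) by (simp add: tendsto_norm_zero_iff)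
  show ?thesis
  proof (rule weakly_converges_zer[OF A _ _ u_mem u0 p])
    show "norm (y (Suc n) - z) \<le> norm (y n - z) + 0" if "z \<in> zer A" for z n
    proof -
      have "(norm (y (Suc n) - z))\<^sup>2 \<le> (norm (y n - z))\<^sup>2"
        using step[OF that, of n] by (smt (verit) zero_le_power2)
      then show ?thesis using power2_le_imp_le[OF _ norm_ge_zero] by simp
    qed
  qed simp
qed

text \<open>Summable errors: for each \<open>m\<close> the exact iteration started at \<open>x m\<close> stays within the tail
  of the error series from \<open>x\<close>, so its weak limits form a Cauchy sequence whose limit is the weak
  limit of \<open>x\<close>. A direct estimate would need the errors divided by \<open>\<gamma>\<close>, which may tend to 0.\<close>

lemma inexact_proximal_point_weakly_converges:
  assumes \<gamma>: "\<And>n. \<gamma> n > 0" "\<not> summable (\<lambda>n. (\<gamma> n)\<^sup>2)"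
    and e: "summable (\<lambda>n. norm (e n))"
    and x: "\<And>n. x (Suc n) = resolvent (\<gamma> n) A (x n) - e n"
  shows "\<exists>l\<in>zer A. weakly_converges x l"
proof -
  \<comment> \<open>\<open>Y m k\<close> is compared with \<open>x (k + m)\<close>, hence the shift
    of the parameters by \<open>m\<close>.\<close>
  define Y where "Y m = rec_nat (x m) (\<lambda>k. resolvent (\<gamma> (k + m)) A)" for m
  have Y0: "Y m 0 = x m" and YS: "Y m (Suc k) = resolvent (\<gamma> (k + m)) A (Y m k)" for m k
    by (simp_all add: Y_def)
  define \<tau> where "\<tau> m = (\<Sum>k. norm (e (k + m)))" for m
  have \<tau>: "\<tau> \<longlonglongrightarrow> 0" unfolding \<tau>_def by (rule suminf_exist_split2[OF e])
  have close: "norm (x (k + m) - Y m k) \<le> \<tau> m" for m k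
  proof -
    have "norm (x (k + m) - Y m k) \<le> (\<Sum>j<k. norm (e (j + m)))"
    proof (induction k)
      case (Suc k)
      have "x (Suc k + m) - Y m (Suc k)
          = (resolvent (\<gamma> (k + m)) A (x (k + m)) - resolvent (\<gamma> (k + m)) A (Y m k)) - e (k + m)"
        by (simp add: YS x)
      then have "norm (x (Suc k + m) - Y m (Suc k)) \<le> norm (x (k + m) - Y m k) + norm (e (k + m))"
        using norm_triangle_ineq4 resolvent_nonexpansive[OF A(1) \<gamma>(1)]
        by (metis (no_types, lifting) add_right_mono order_trans)
      then show ?case using Suc by simp
    qed (simp add: Y0)
    also have "\<dots> \<le> \<tau> m"
      unfolding \<tau>_def by (intro sum_le_suminf summable_ignore_initial_segment[OF e]) auto
    finally show ?thesis .
  qed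
  have "\<exists>l\<in>zer A. weakly_converges (Y m) l" for m
  proof (rule proximal_point_weakly_converges)
    show "\<not> summable (\<lambda>k. (\<gamma> (k + m))\<^sup>2)"
      using \<gamma>(2) summable_iff_shift[of "\<lambda>n. (\<gamma> n)\<^sup>2" m] by simp
  qed (use \<gamma>(1) YS in auto)
  then obtain w where w: "\<And>m. w m \<in> zer A" "\<And>m. weakly_converges (Y m) (w m)" by metis
  have w_dist: "dist (w m) (w k) \<le> \<tau> m + \<tau> k" for m k
    unfolding dist_norm
  proof (rule weakly_converges_norm_le[OF weakly_converges_diff])
    \<comment> \<open>Both shifted sequences follow \<open>x\<close> at the common time
      \<open>n + m + k\<close>, up to \<open>\<tau> m\<close> and \<open>\<tau> k\<close>.\<close>
    show "weakly_converges (Y m \<circ> (\<lambda>n. n + k)) (w m)" "weakly_converges (Y k \<circ> (\<lambda>n. n + m)) (w k)"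
      by (intro weakly_converges_subseq w(2) strict_monoI; simp)+
    fix n
    have "(Y m \<circ> (\<lambda>n. n + k)) n - (Y k \<circ> (\<lambda>n. n + m)) n
        = (x ((n + m) + k) - Y k (n + m)) - (x ((n + k) + m) - Y m (n + k))"
      by (simp add: add.commute add.left_commute)
    then show "norm ((Y m \<circ> (\<lambda>n. n + k)) n - (Y k \<circ> (\<lambda>n. n + m)) n) \<le> \<tau> m + \<tau> k"
      using norm_triangle_ineq4[of "x ((n + m) + k) - Y k (n + m)" "x ((n + k) + m) - Y m (n + k)"]
        close[of "n + m" k] close[of "n + k" m] by simp
  qed
  have "Cauchy w"
  proof (rule metric_CauchyI)
    fix r :: real assume "0 < r"
    then obtain N where N: "\<And>n. n \<ge> N \<Longrightarrow> \<tau> n < r / 2"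
      using LIMSEQ_D[OF \<tau>, of "r / 2"] by force
    have "dist (w m) (w n) < r" if "m \<ge> N" "n \<ge> N" for m n
      using w_dist[of m n] N[OF that(1)] N[OF that(2)] by simp
    then show "\<exists>N. \<forall>m\<ge>N. \<forall>n\<ge>N. dist (w m) (w n) < r" by blast
  qed
  then obtain l where l: "w \<longlonglongrightarrow> l"
    using Cauchy_convergent_iff convergent_def by blast
  \<comment> \<open>The set of zeros is closed: the monotonicity inequalities pass to the limit and
    maximality returns a graph point.\<close>
  have "0 \<in> A l"
  proof (rule maximally_monotone_mem[OF A(1)])
    fix y v assume v: "v \<in> A y"
    have "0 \<le> (w m - y) \<bullet> (0 - v)" for m
      using w(1)[of m] v by (intro maximally_monotoneD[OF A(1)]) (auto simp: zer_def)
    moreover have "(\<lambda>m. (w m - y) \<bullet> (0 - v)) \<longlonglongrightarrow> (l - y) \<bullet> (0 - v)"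
      by (intro tendsto_intros l)
    ultimately show "0 \<le> (l - y) \<bullet> (0 - v)" by (intro LIMSEQ_le_const) auto
  qed
  moreover have "weakly_converges x l"
    unfolding weakly_converges_def
  proof
    fix h
    show "(\<lambda>n. x n \<bullet> h) \<longlonglongrightarrow> l \<bullet> h"
    proof (rule LIMSEQ_I)
      fix r :: real assume r: "0 < r"
      \<comment> \<open>First fix \<open>m\<close> so that the norm errors
        \<open>x n - Y m k\<close> and \<open>w m - l\<close> are small uniformly in
        \<open>n\<close>; the weak convergence of this one \<open>Y m\<close> then handles the
        rest.\<close>
      have "(\<lambda>m. (\<tau> m + norm (w m - l)) * norm h) \<longlonglongrightarrow> (0 + norm (l - l)) * norm h"
        by (intro tendsto_intros \<tau> l)
      then have "\<forall>\<^sub>F m in sequentially. (\<tau> m + norm (w m - l)) * norm h < r / 2"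
        using r by (intro order_tendstoD) auto
      then obtain m where m: "(\<tau> m + norm (w m - l)) * norm h < r / 2"
        by (auto simp: eventually_sequentially)
      obtain N where N: "\<And>k. k \<ge> N \<Longrightarrow> \<bar>Y m k \<bullet> h - w m \<bullet> h\<bar> < r / 2"
        using LIMSEQ_D[of "\<lambda>k. Y m k \<bullet> h" "w m \<bullet> h" "r / 2"] w(2)[of m] r
        by (auto simp: weakly_converges_def)
      have "norm (x n \<bullet> h - l \<bullet> h) < r" if n: "n \<ge> N + m" for n
      proof -
        define k where "k = n - m"
        have k: "n = k + m" "k \<ge> N" using n by (auto simp: k_def)
        have "norm ((x n - Y m k) + (w m - l)) \<le> \<tau> m + norm (w m - l)"
          using norm_triangle_ineq[of "x n - Y m k" "w m - l"] close[of k m] k by simp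
        then have "norm ((x n - Y m k) + (w m - l)) * norm h < r / 2"
          using mult_right_mono[OF _ norm_ge_zero[of h]] m by (meson le_less_trans)
        then have "\<bar>((x n - Y m k) + (w m - l)) \<bullet> h\<bar> < r / 2"
          using Cauchy_Schwarz_ineq2 le_less_trans by blast
        moreover have "x n \<bullet> h - l \<bullet> h
            = ((x n - Y m k) + (w m - l)) \<bullet> h + (Y m k \<bullet> h - w m \<bullet> h)"
          by (simp add: inner_add_left inner_diff_left)
        ultimately show ?thesis using N[OF k(2)] unfolding real_norm_def by linarith
      qed
      then show "\<exists>N. \<forall>n\<ge>N. norm (x n \<bullet> h - l \<bullet> h) < r" by blast
    qed
  qed
  ultimately show ?thesis by (auto simp: zer_def)
qed

end

section \<open>Measurability, summation and independence\<close>

text \<open>Used where a function is determined only almost surely: for the iterates, through their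
  recursion, and for the weak limit.\<close>

lemma (in complete_measure) measurable_cong_AE:
  assumes f: "f \<in> measurable M N" and eq: "AE x in M. f x = g x"
    and g: "g \<in> space M \<rightarrow> space N"
  shows "g \<in> measurable M N"
proof (rule measurableI)
  fix B assume B: "B \<in> sets N"
  show "g -` B \<inter> space M \<in> sets M"
  proof (rule in_sets_AE)
    show "f -` B \<inter> space M \<in> sets M" using f B by (rule measurable_sets)
    show "AE x in M. x \<in> f -` B \<inter> space M \<longleftrightarrow> x \<in> g -` B \<inter> space M"
      using eq by eventually_elim auto
  qed auto
qed (use g in auto)

text \<open>Writes membership in a closed ball as countably many inner product conditions when
  \<open>D\<close> is countable. If the norm bound failed, the open set of violating
  \<open>d\<close> would contain \<open>u\<close> and therefore meet \<open>D\<close>.\<close>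

lemma norm_le_iff_inner_dense:
  fixes u :: "'h::real_inner"
  assumes D: "\<And>X. open X \<Longrightarrow> X \<noteq> {} \<Longrightarrow> \<exists>d\<in>D. d \<in> X"
  shows "norm u \<le> r \<longleftrightarrow> 0 \<le> r \<and> (\<forall>d\<in>D. u \<bullet> d \<le> r * norm d)"
proof (intro iffI conjI ballI)
  assume u: "norm u \<le> r"
  then show "0 \<le> r" using order_trans[OF norm_ge_zero] by blast
  show "u \<bullet> d \<le> r * norm d" for d
    using norm_cauchy_schwarz[of u d] mult_right_mono[OF u norm_ge_zero[of d]] by simp
next
  assume r: "0 \<le> r \<and> (\<forall>d\<in>D. u \<bullet> d \<le> r * norm d)"
  have "u \<bullet> u \<le> r * norm u"
  proof (rule ccontr)
    assume "\<not> u \<bullet> u \<le> r * norm u"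
    then have "u \<in> {d. r * norm d < u \<bullet> d}" by simp
    moreover have "open {d. r * norm d < u \<bullet> d}"
      by (intro open_Collect_less continuous_intros)
    ultimately obtain d where "d \<in> D" "r * norm d < u \<bullet> d" using D by blast
    then show False using r by force
  qed
  then have "norm u * norm u \<le> r * norm u"
    by (simp add: power2_norm_eq_inner flip: power2_eq_square)
  then show "norm u \<le> r" using r by (cases "u = 0") auto
qed

text \<open>Pettis' theorem for a separable space: preimages of closed balls are measurable by the
  preceding lemma, and an open set is a countable union of closed balls.\<close>

lemma borel_measurable_if_inner_measurable:
  fixes f :: "'a \<Rightarrow> 'h::{real_inner, second_countable_topology}"
  assumes [measurable]: "\<And>y. (\<lambda>\<omega>. f \<omega> \<bullet> y) \<in> borel_measurable M"
  shows "f \<in> borel_measurable M"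
proof (rule borel_measurableI)
  fix U :: "'h set" assume U: "open U"
  obtain D :: "'h set" where D: "countable D" "\<And>X. open X \<Longrightarrow> X \<noteq> {} \<Longrightarrow> \<exists>d\<in>D. d \<in> X"
    by (rule countable_dense_setE) blast
  have cball: "f -` cball c r \<inter> space M \<in> sets M" for c r
  proof -
    have "f -` cball c r \<inter> space M
        = {\<omega> \<in> space M. 0 \<le> r \<and> (\<forall>d\<in>D. f \<omega> \<bullet> d - c \<bullet> d \<le> r * norm d)}"
      using norm_le_iff_inner_dense[OF D(2), of "f _ - c" r]
      by (auto simp: dist_norm norm_minus_commute inner_diff_left)
    also have "\<dots> \<in> sets M"
      using D(1) by measurable
    finally show ?thesis .
  qed
  define I where "I = {(c, r). c \<in> D \<and> r \<in> \<rat> \<and> cball c r \<subseteq> U}"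
  have "countable I"
    by (rule countable_subset[of _ "D \<times> \<rat>"]) (auto simp: I_def D(1) countable_rat)
  have "U \<subseteq> (\<Union>(c, r)\<in>I. cball c r)"
  proof
    fix x assume "x \<in> U"
    then obtain e where e: "e > 0" "ball x e \<subseteq> U" using U open_contains_ball by blast
    obtain c where c: "c \<in> D" "dist x c < e / 3"
      using D(2)[of "ball x (e / 3)"] e(1) by auto
    obtain r where r: "r \<in> \<rat>" "e / 3 < r" "r < e / 2"
      using Rats_dense_in_real[of "e / 3" "e / 2"] e(1) by auto
    \<comment> \<open>Radii between \<open>e / 3\<close> and \<open>e / 2\<close> reach
      \<open>x\<close> from \<open>c\<close>, while \<open>e / 3 + r\<close> stays below
      \<open>e\<close>.\<close>
    have "cball c r \<subseteq> ball x e"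
    proof
      fix y assume "y \<in> cball c r"
      then show "y \<in> ball x e" using dist_triangle[of x y c] c(2) r(2,3) by simp
    qed
    then have "(c, r) \<in> I" using c r e(2) by (auto simp: I_def)
    moreover have "x \<in> cball c r" using c(2) r(2) by (simp add: dist_commute)
    ultimately show "x \<in> (\<Union>(c, r)\<in>I. cball c r)" by blast
  qed
  moreover have "(\<Union>(c, r)\<in>I. cball c r) \<subseteq> U" by (auto simp: I_def)
  ultimately have "U = (\<Union>i\<in>I. cball (fst i) (snd i))" unfolding case_prod_unfold by (rule equalityI)
  then have "f -` U \<inter> space M = (\<Union>i\<in>I. f -` cball (fst i) (snd i) \<inter> space M)" by blast
  also have "\<dots> \<in> sets M"
    using \<open>countable I\<close> cball by (intro sets.countable_UN') auto
  finally show "f -` U \<inter> space M \<in> sets M" .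
qed

text \<open>Monotone convergence in \<open>ennreal\<close> makes the series almost surely finite,
  which is real summability.\<close>

lemma
  fixes f :: "nat \<Rightarrow> 'a \<Rightarrow> real"
  assumes int: "\<And>n. integrable M (f n)" and nonneg: "\<And>n. AE \<omega> in M. 0 \<le> f n \<omega>"
    and summ: "summable (\<lambda>n. \<integral>\<omega>. f n \<omega> \<partial>M)"
  shows AE_summable_if_summable_integral: "AE \<omega> in M. summable (\<lambda>n. f n \<omega>)"
    and integrable_suminf_nonneg: "integrable M (\<lambda>\<omega>. \<Sum>n. f n \<omega>)"
proof -
  have nn: "AE \<omega> in M. \<forall>n. 0 \<le> f n \<omega>" using nonneg by (simp add: AE_all_countable)
  have [measurable]: "f n \<in> borel_measurable M" for n using int by (rule borel_measurable_integrable)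
  have "(\<integral>\<^sup>+\<omega>. (\<Sum>n. ennreal (f n \<omega>)) \<partial>M) = (\<Sum>n. \<integral>\<^sup>+\<omega>. ennreal (f n \<omega>) \<partial>M)"
    by (rule nn_integral_suminf) measurable
  also have "\<dots> = (\<Sum>n. ennreal (\<integral>\<omega>. f n \<omega> \<partial>M))"
    using int nonneg by (simp add: nn_integral_eq_integral)
  also have "\<dots> \<noteq> \<infinity>"
    using summ nonneg unfolding infinity_ennreal_def
    by (intro ennreal_suminf_neq_top) (auto intro: integral_nonneg_AE)
  finally have "AE \<omega> in M. (\<Sum>n. ennreal (f n \<omega>)) \<noteq> \<infinity>"
    by (intro nn_integral_PInf_AE) measurable
  with nn show summ_AE: "AE \<omega> in M. summable (\<lambda>n. f n \<omega>)"
    by eventually_elim (auto intro: summable_suminf_not_top)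
  show "integrable M (\<lambda>\<omega>. \<Sum>n. f n \<omega>)"
  proof (rule integrable_suminf[OF int])
    show "AE \<omega> in M. summable (\<lambda>n. norm (f n \<omega>))"
      using summ_AE nn by eventually_elim simp
    have "(\<integral>\<omega>. norm (f n \<omega>) \<partial>M) = (\<integral>\<omega>. f n \<omega> \<partial>M)" for n
      using nonneg[of n] by (intro integral_cong_AE) auto
    then show "summable (\<lambda>n. \<integral>\<omega>. norm (f n \<omega>) \<partial>M)" using summ by simp
  qed
qed

text \<open>By the Cauchy--Schwarz inequality with weights \<open>s n\<close>, the square of the series is at most
  the sum of \<open>s n\<close> times the sum of \<open>(b n)\<^sup>2 / s n\<close>; the summand \<open>(1/2)^n\<close> only keeps the weights
  positive.\<close>

lemma L2_summable_dominated:
  fixes b :: "nat \<Rightarrow> 'a \<Rightarrow> real"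
  assumes int: "\<And>n. integrable M (\<lambda>\<omega>. (b n \<omega>)\<^sup>2)"
    and nonneg: "\<And>n. AE \<omega> in M. 0 \<le> b n \<omega>"
    and summ: "summable (\<lambda>n. sqrt (\<integral>\<omega>. (b n \<omega>)\<^sup>2 \<partial>M))"
  obtains \<Phi> where "\<Phi> \<in> borel_measurable M" "integrable M (\<lambda>\<omega>. (\<Phi> \<omega>)\<^sup>2)"
    "AE \<omega> in M. summable (\<lambda>n. b n \<omega>) \<and> (\<Sum>n. b n \<omega>) \<le> \<Phi> \<omega> \<and> 0 \<le> \<Phi> \<omega>"
proof -
  define s where "s n = sqrt (\<integral>\<omega>. (b n \<omega>)\<^sup>2 \<partial>M) + (1/2)^n" for n
  have s: "s n > 0" for n by (simp add: s_def add_nonneg_pos)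
  have s_summ: "summable s"
    unfolding s_def by (intro summable_add summ summable_geometric) simp
  define S where "S = suminf s"
  define \<Psi> where "\<Psi> \<omega> = (\<Sum>n. (b n \<omega>)\<^sup>2 / s n)" for \<omega>
  have int': "integrable M (\<lambda>\<omega>. (b n \<omega>)\<^sup>2 / s n)" for n using int[of n] by simp
  \<comment> \<open>Each integral is at most \<open>s n\<close>, because \<open>s n\<close> is at
    least the \<open>L^2\<close> norm of \<open>b n\<close>.\<close>
  have "summable (\<lambda>n. \<integral>\<omega>. (b n \<omega>)\<^sup>2 / s n \<partial>M)"
  proof (rule summable_comparison_test'[OF s_summ])
    fix n
    define I where "I = (\<integral>\<omega>. (b n \<omega>)\<^sup>2 \<partial>M)"
    have I: "0 \<le> I" by (simp add: I_def)
    have "I = sqrt I * sqrt I" using I by simp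
    also have "\<dots> \<le> s n * s n"
      using I by (intro mult_mono) (auto simp: s_def I_def)
    finally show "norm (\<integral>\<omega>. (b n \<omega>)\<^sup>2 / s n \<partial>M) \<le> s n"
      using s[of n] I by (simp add: I_def[symmetric] pos_divide_le_eq)
  qed
  moreover have "AE \<omega> in M. 0 \<le> (b n \<omega>)\<^sup>2 / s n" for n using s[of n] by simp
  ultimately have \<Psi>_int: "integrable M \<Psi>"
    and \<Psi>_summ: "AE \<omega> in M. summable (\<lambda>n. (b n \<omega>)\<^sup>2 / s n)"
    unfolding \<Psi>_def
    using integrable_suminf_nonneg[of M "\<lambda>n \<omega>. (b n \<omega>)\<^sup>2 / s n", OF int']
      AE_summable_if_summable_integral[of M "\<lambda>n \<omega>. (b n \<omega>)\<^sup>2 / s n", OF int']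
    by blast+
  have nn: "AE \<omega> in M. \<forall>n. 0 \<le> b n \<omega>" using nonneg by (simp add: AE_all_countable)
  have S: "0 \<le> S" unfolding S_def using s by (intro suminf_nonneg s_summ) (simp add: less_imp_le)
  have \<Psi>_nonneg: "0 \<le> \<Psi> \<omega>" if "summable (\<lambda>n. (b n \<omega>)\<^sup>2 / s n)" for \<omega>
    unfolding \<Psi>_def using s by (intro suminf_nonneg that) (simp add: less_imp_le)
  show thesis
  proof (rule that[of "\<lambda>\<omega>. sqrt (S * \<Psi> \<omega>)"])
    show "(\<lambda>\<omega>. sqrt (S * \<Psi> \<omega>)) \<in> borel_measurable M"
      using \<Psi>_int by measurable
    have "integrable M (\<lambda>\<omega>. S * \<Psi> \<omega>)" using \<Psi>_int by simp
    \<comment> \<open>Nonnegativity of \<open>\<Psi>\<close> is available only where its series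
      converges, so the square root is undone almost everywhere.\<close>
    moreover have "AE \<omega> in M. S * \<Psi> \<omega> = (sqrt (S * \<Psi> \<omega>))\<^sup>2"
      using \<Psi>_summ by eventually_elim (simp add: S \<Psi>_nonneg)
    moreover have "(\<lambda>\<omega>. (sqrt (S * \<Psi> \<omega>))\<^sup>2) \<in> borel_measurable M"
      using \<Psi>_int by measurable
    ultimately show "integrable M (\<lambda>\<omega>. (sqrt (S * \<Psi> \<omega>))\<^sup>2)"
      by (metis (no_types) integrable_cong_AE_imp)
    show "AE \<omega> in M. summable (\<lambda>n. b n \<omega>) \<and> (\<Sum>n. b n \<omega>) \<le> sqrt (S * \<Psi> \<omega>) \<and> 0 \<le> sqrt (S * \<Psi> \<omega>)"
      using \<Psi>_summ nn
    proof eventually_elim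
      case (elim \<omega>)
      have "(\<Sum>n<N. b n \<omega>) \<le> sqrt (S * \<Psi> \<omega>)" for N
      proof (rule real_le_rsqrt)
        have "(\<Sum>n<N. b n \<omega>)\<^sup>2 = (\<Sum>n<N. sqrt (s n) * (b n \<omega> / sqrt (s n)))\<^sup>2"
          using s by (simp add: less_imp_neq[symmetric])
        also have "\<dots> \<le> (\<Sum>n<N. (sqrt (s n))\<^sup>2) * (\<Sum>n<N. (b n \<omega> / sqrt (s n))\<^sup>2)"
          by (rule Cauchy_Schwarz_ineq_sum)
        also have "\<dots> = (\<Sum>n<N. s n) * (\<Sum>n<N. (b n \<omega>)\<^sup>2 / s n)"
          using s by (simp add: power_divide less_imp_le)
        also have "\<dots> \<le> S * \<Psi> \<omega>"
          unfolding S_def \<Psi>_def using s S elim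
          by (intro mult_mono sum_le_suminf sum_nonneg) (auto simp: s_summ S_def less_imp_le)
        finally show "(\<Sum>n<N. b n \<omega>)\<^sup>2 \<le> S * \<Psi> \<omega>" .
      qed
      moreover from this have "summable (\<lambda>n. b n \<omega>)"
        using elim by (intro summableI_nonneg_bounded) auto
      ultimately show ?case
        using S \<Psi>_nonneg[OF elim(1)] by (auto intro: suminf_le_const)
    qed
  qed
qed

text \<open>Independence passes to the smaller sigma-algebras generated by Borel functions of one
  member of each family. In the iteration this separates \<open>lam n\<close> from functions of
  \<open>x n\<close> or of \<open>e n\<close>.\<close>

lemma (in prob_space) integral_mult_indep:
  fixes X :: "'a \<Rightarrow> 'b::topological_space" and Y :: "'a \<Rightarrow> 'c::topological_space"
    and h g :: "_ \<Rightarrow> real"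
  assumes ind: "indep_set (generated_sigma M F) (generated_sigma M G)"
    and mem: "X \<in> F" "Y \<in> G"
    and [measurable]: "X \<in> borel_measurable M" "Y \<in> borel_measurable M"
      "h \<in> borel_measurable borel" "g \<in> borel_measurable borel"
    and int: "integrable M (\<lambda>\<omega>. h (X \<omega>))" "integrable M (\<lambda>\<omega>. g (Y \<omega>))"
  shows "(\<integral>\<omega>. h (X \<omega>) * g (Y \<omega>) \<partial>M) = (\<integral>\<omega>. h (X \<omega>) \<partial>M) * (\<integral>\<omega>. g (Y \<omega>) \<partial>M)"
    and "integrable M (\<lambda>\<omega>. h (X \<omega>) * g (Y \<omega>))"
proof -
  have sub: "sigma_sets (space M) {(\<lambda>\<omega>. f (Z \<omega>)) -` B \<inter> space M | B. B \<in> sets borel}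
      \<subseteq> generated_sigma M H" if "Z \<in> H" "f \<in> borel_measurable borel"
    for Z :: "'a \<Rightarrow> 'd::topological_space" and f :: "'d \<Rightarrow> real" and H
    unfolding generated_sigma_def
  proof (rule sigma_sets_mono', rule subsetI)
    fix E assume "E \<in> {(\<lambda>\<omega>. f (Z \<omega>)) -` B \<inter> space M | B. B \<in> sets borel}"
    then obtain B where "E = Z -` (f -` B) \<inter> space M" "B \<in> sets borel" by auto
    moreover from this that(2) have "f -` B \<in> sets borel"
      using measurable_sets[of f borel borel B] by simp
    ultimately show "E \<in> (\<Union>Z\<in>H. {Z -` B \<inter> space M | B. B \<in> sets borel})"
      using that(1) by blast
  qed
  have "indep_var borel (\<lambda>\<omega>. h (X \<omega>)) borel (\<lambda>\<omega>. g (Y \<omega>))"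
    unfolding indep_var_eq
  proof (intro conjI)
    show "indep_set (sigma_sets (space M) {(\<lambda>\<omega>. h (X \<omega>)) -` B \<inter> space M | B. B \<in> sets borel})
        (sigma_sets (space M) {(\<lambda>\<omega>. g (Y \<omega>)) -` B \<inter> space M | B. B \<in> sets borel})"
      using ind sub[OF mem(1), of h] sub[OF mem(2), of g]
      unfolding indep_sets2_eq by (meson assms(6,7) order_trans subset_iff)
  qed measurable
  note * = this int
  show "(\<integral>\<omega>. h (X \<omega>) * g (Y \<omega>) \<partial>M) = (\<integral>\<omega>. h (X \<omega>) \<partial>M) * (\<integral>\<omega>. g (Y \<omega>) \<partial>M)"
    by (rule indep_var_lebesgue_integral[OF *])
  show "integrable M (\<lambda>\<omega>. h (X \<omega>) * g (Y \<omega>))"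
    by (rule indep_var_integrable[OF *])
qed

section \<open>The stochastic iteration\<close>

lemma power2_sum3_le: "(a + b + c)\<^sup>2 \<le> 3 * (a\<^sup>2 + b\<^sup>2 + c\<^sup>2)" for a b c :: real
  using zero_le_power2[of "a - b"] zero_le_power2[of "b - c"] zero_le_power2[of "a - c"]
  by (simp add: power2_eq_square algebra_simps)

text \<open>The hypotheses common to the three cases; the specific conditions enter as premises of
  the lemmas below.\<close>

locale random_inexact_proximal = prob_space M + complete_measure M
  for M :: "'a measure" +
  fixes A :: "'h::{real_inner, polish_space} \<Rightarrow> 'h set"
    and \<gamma> :: "nat \<Rightarrow> real"
    and x e :: "nat \<Rightarrow> 'a \<Rightarrow> 'h"
    and lam :: "nat \<Rightarrow> 'a \<Rightarrow> real"
  assumes A: "maximally_monotone A" "zer A \<noteq> {}"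
    and \<gamma>: "\<And>n. \<gamma> n > 0"
    and x0: "x 0 \<in> L2 M"
    and e: "\<And>n. e n \<in> L2 M"
    and lam: "\<And>n. lam n \<in> borel_measurable M" "\<And>n. AE \<omega> in M. lam n \<omega> \<in> {0<..<2}"
    and step: "\<And>n. AE \<omega> in M.
      x (Suc n) \<omega> = x n \<omega> + lam n \<omega> *\<^sub>R (resolvent (\<gamma> n) A (x n \<omega>) - e n \<omega> - x n \<omega>)"
    and indep: "\<And>n. indep_set
      (generated_sigma M {lam n}) (generated_sigma M (x ` {0..n} \<union> {e n}))"
begin

definition J :: "nat \<Rightarrow> 'h \<Rightarrow> 'h" where "J n = resolvent (\<gamma> n) A"

definition err :: "nat \<Rightarrow> 'a \<Rightarrow> real" where "err n \<omega> = lam n \<omega> * norm (e n \<omega>)"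

definition res :: "nat \<Rightarrow> 'a \<Rightarrow> real" where "res n \<omega> = norm (J n (x n \<omega>) - x n \<omega>)"

text \<open>Mentions no zero of \<open>A\<close>, so one null set serves every \<open>z\<close> and
  every \<open>n\<close>.\<close>

definition good :: "'a \<Rightarrow> bool" where
  "good \<omega> \<longleftrightarrow> (\<forall>n. 0 < lam n \<omega> \<and> lam n \<omega> < 2 \<and>
     x (Suc n) \<omega> = x n \<omega> + lam n \<omega> *\<^sub>R (J n (x n \<omega>) - e n \<omega> - x n \<omega>))"

lemma AE_good: "AE \<omega> in M. good \<omega>"
  unfolding good_def AE_all_countable
proof
  fix n
  show "AE \<omega> in M. 0 < lam n \<omega> \<and> lam n \<omega> < 2 \<and>
     x (Suc n) \<omega> = x n \<omega> + lam n \<omega> *\<^sub>R (J n (x n \<omega>) - e n \<omega> - x n \<omega>)"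
    using lam(2)[of n] step[of n] by eventually_elim (simp add: J_def)
qed

lemma J_measurable [measurable]: "J n \<in> borel_measurable borel"
proof (rule borel_measurable_continuous_onI, rule continuous_onI)
  fix u w :: 'h and \<epsilon> :: real assume "0 < \<epsilon>"
  then show "\<exists>d>0. \<forall>v\<in>UNIV. dist v u < d \<longrightarrow> dist (J n v) (J n u) \<le> \<epsilon>"
    by (intro exI[of _ \<epsilon>])
      (auto simp: J_def dist_norm intro: order_trans[OF resolvent_nonexpansive[OF A(1) \<gamma>]] less_imp_le)
qed

lemma err_nonneg: "good \<omega> \<Longrightarrow> 0 \<le> err n \<omega>"
  by (simp add: good_def err_def less_imp_le)

lemma res_nonneg: "0 \<le> res n \<omega>"
  by (simp add: res_def)

lemma good_dist:
  assumes "good \<omega>" "z \<in> zer A"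
  shows "norm (x (Suc n) \<omega> - z) \<le> norm (x n \<omega> - z) + err n \<omega>"
    and "(norm (x (Suc n) \<omega> - z))\<^sup>2 \<le> (norm (x n \<omega> - z))\<^sup>2
      - lam n \<omega> * (2 - lam n \<omega>) * (res n \<omega>)\<^sup>2 + 2 * norm (x (Suc n) \<omega> - z) * err n \<omega>"
proof -
  have "0 \<le> lam n \<omega>" "lam n \<omega> \<le> 2"
    "x (Suc n) \<omega> = x n \<omega> + lam n \<omega> *\<^sub>R (resolvent (\<gamma> n) A (x n \<omega>) - e n \<omega> - x n \<omega>)"
    using assms(1) by (auto simp: good_def J_def less_imp_le)
  note * = relaxed_inexact_resolvent_dist[OF A(1) \<gamma> assms(2) this]
  show "norm (x (Suc n) \<omega> - z) \<le> norm (x n \<omega> - z) + err n \<omega>"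
    unfolding err_def by (rule *(1))
  show "(norm (x (Suc n) \<omega> - z))\<^sup>2 \<le> (norm (x n \<omega> - z))\<^sup>2
      - lam n \<omega> * (2 - lam n \<omega>) * (res n \<omega>)\<^sup>2 + 2 * norm (x (Suc n) \<omega> - z) * err n \<omega>"
    unfolding err_def res_def J_def by (rule *(2))
qed

section \<open>Measurability, integrability and factorization of expectations\<close>

lemma lam_measurable [measurable]: "lam n \<in> borel_measurable M"
  by (rule lam)

lemma e_measurable [measurable]: "e n \<in> borel_measurable M"
  using e by (simp add: L2_def)

lemma e_square_integrable: "integrable M (\<lambda>\<omega>. (norm (e n \<omega>))\<^sup>2)"
  using e by (simp add: L2_def)

text \<open>Induction along the distance bound, with \<open>err n \<omega>\<close> replaced by
  \<open>2 * norm (e n \<omega>)\<close> since \<open>lam n\<close> is below 2. Measurability relies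
  on completeness, as the recursion holds only almost surely.\<close>

lemma x_L2: "x n \<in> L2 M"
proof (induction n)
  case (Suc n)
  then have [measurable]: "x n \<in> borel_measurable M"
    and int: "integrable M (\<lambda>\<omega>. (norm (x n \<omega>))\<^sup>2)" by (auto simp: L2_def)
  have [measurable]: "x (Suc n) \<in> borel_measurable M"
  proof (rule measurable_cong_AE)
    show "(\<lambda>\<omega>. x n \<omega> + lam n \<omega> *\<^sub>R (J n (x n \<omega>) - e n \<omega> - x n \<omega>)) \<in> borel_measurable M"
      by measurable
    show "AE \<omega> in M. x n \<omega> + lam n \<omega> *\<^sub>R (J n (x n \<omega>) - e n \<omega> - x n \<omega>) = x (Suc n) \<omega>"
      using AE_good by eventually_elim (simp add: good_def)
  qed simp
  obtain z where z: "z \<in> zer A" using A(2) by blast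
  have "integrable M (\<lambda>\<omega>. (norm (x (Suc n) \<omega>))\<^sup>2)"
  proof (rule Bochner_Integration.integrable_bound)
    show "integrable M (\<lambda>\<omega>. 3 * ((norm (x n \<omega>))\<^sup>2 + (2 * norm z)\<^sup>2 + 4 * (norm (e n \<omega>))\<^sup>2))"
      using int e_square_integrable[of n] by simp
    show "AE \<omega> in M. norm ((norm (x (Suc n) \<omega>))\<^sup>2)
        \<le> norm (3 * ((norm (x n \<omega>))\<^sup>2 + (2 * norm z)\<^sup>2 + 4 * (norm (e n \<omega>))\<^sup>2))"
      using AE_good
    proof eventually_elim
      case (elim \<omega>)
      have "err n \<omega> \<le> 2 * norm (e n \<omega>)"
        using elim unfolding err_def good_def by (intro mult_right_mono) (auto simp: less_imp_le)
      then have le: "norm (x (Suc n) \<omega>) \<le> norm (x n \<omega>) + 2 * norm z + 2 * norm (e n \<omega>)"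
        using good_dist(1)[OF elim z, of n] norm_triangle_ineq4[of "x n \<omega>" z]
          norm_triangle_ineq[of "x (Suc n) \<omega> - z" z] by simp
      have "(norm (x (Suc n) \<omega>))\<^sup>2 \<le> (norm (x n \<omega>) + 2 * norm z + 2 * norm (e n \<omega>))\<^sup>2"
        using le by (rule power_mono) simp
      also have "\<dots> \<le> 3 * ((norm (x n \<omega>))\<^sup>2 + (2 * norm z)\<^sup>2 + (2 * norm (e n \<omega>))\<^sup>2)"
        by (rule power2_sum3_le)
      finally show ?case by (simp add: power_mult_distrib)
    qed
  qed measurable
  then show ?case by (simp add: L2_def)
qed (rule x0)

lemma x_measurable [measurable]: "x n \<in> borel_measurable M"
  using x_L2 by (simp add: L2_def)

lemma res_measurable [measurable]: "res n \<in> borel_measurable M"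
  unfolding res_def[abs_def] by measurable

lemma err_measurable [measurable]: "err n \<in> borel_measurable M"
  unfolding err_def[abs_def] by measurable

lemma bounded_lam_integrable:
  assumes [measurable]: "h \<in> borel_measurable borel"
    and "\<And>t. 0 < t \<Longrightarrow> t < 2 \<Longrightarrow> \<bar>h t\<bar> \<le> (c :: real)"
  shows "integrable M (\<lambda>\<omega>. h (lam n \<omega>))"
proof (rule integrable_const_bound[of _ c])
  show "AE \<omega> in M. norm (h (lam n \<omega>)) \<le> c"
    using lam(2)[of n] by eventually_elim (simp add: assms(2))
qed measurable

lemma lam_weight_bounds: "0 < t \<Longrightarrow> t < 2 \<Longrightarrow> \<bar>t * (2 - t)\<bar> \<le> (4::real)"
proof -
  assume t: "0 < t" "t < 2"
  then have "t * (2 - t) \<le> 2 * 2" by (intro mult_mono) auto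
  then show ?thesis using t by (simp add: abs_mult)
qed

lemma lam_weight_integrable: "integrable M (\<lambda>\<omega>. lam n \<omega> * (2 - lam n \<omega>))"
  by (rule bounded_lam_integrable[OF _ lam_weight_bounds]) measurable

lemma lam_weight_nonneg: "0 \<le> (\<integral>\<omega>. lam n \<omega> * (2 - lam n \<omega>) \<partial>M)"
proof (rule integral_nonneg_AE)
  show "AE \<omega> in M. 0 \<le> lam n \<omega> * (2 - lam n \<omega>)"
    using lam(2)[of n] by eventually_elim simp
qed

lemma res_le_dist: "z \<in> zer A \<Longrightarrow> res n \<omega> \<le> norm (x n \<omega> - z)"
  unfolding res_def J_def by (rule resolvent_residual_le[OF A(1) \<gamma>])

lemma res_square_integrable: "integrable M (\<lambda>\<omega>. (res n \<omega>)\<^sup>2)"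
proof -
  obtain z where z: "z \<in> zer A" using A(2) by blast
  show ?thesis
  proof (rule Bochner_Integration.integrable_bound)
    show "integrable M (\<lambda>\<omega>. 2 * ((norm (x n \<omega>))\<^sup>2 + (norm z)\<^sup>2))"
      using x_L2[of n] by (simp add: L2_def)
    have "(res n \<omega>)\<^sup>2 \<le> 2 * ((norm (x n \<omega>))\<^sup>2 + (norm z)\<^sup>2)" for \<omega>
    proof -
      have "res n \<omega> \<le> norm (x n \<omega>) + norm z"
        using res_le_dist[OF z] norm_triangle_ineq4 order_trans by blast
      then have "(res n \<omega>)\<^sup>2 \<le> (norm (x n \<omega>) + norm z)\<^sup>2"
        using res_nonneg by (rule power_mono)
      also have "\<dots> \<le> 2 * ((norm (x n \<omega>))\<^sup>2 + (norm z)\<^sup>2)"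
        using zero_le_power2[of "norm (x n \<omega>) - norm z"] by (simp add: power2_sum power2_diff)
      finally show ?thesis .
    qed
    then show "AE \<omega> in M. norm ((res n \<omega>)\<^sup>2) \<le> norm (2 * ((norm (x n \<omega>))\<^sup>2 + (norm z)\<^sup>2))"
      by (intro AE_I2) (simp add: order_trans[OF _ abs_ge_self])
  qed measurable
qed

text \<open>\<open>J n\<close> is not random, so \<open>res n\<close> is a Borel function of
  \<open>x n\<close>, a member of the family from which \<open>lam n\<close> is independent.\<close>

lemma
  shows integral_weight_res:
    "(\<integral>\<omega>. lam n \<omega> * (2 - lam n \<omega>) * (res n \<omega>)\<^sup>2 \<partial>M)
      = (\<integral>\<omega>. lam n \<omega> * (2 - lam n \<omega>) \<partial>M) * (\<integral>\<omega>. (res n \<omega>)\<^sup>2 \<partial>M)"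
    and integrable_weight_res: "integrable M (\<lambda>\<omega>. lam n \<omega> * (2 - lam n \<omega>) * (res n \<omega>)\<^sup>2)"
proof -
  have "(\<lambda>u. (norm (J n u - u))\<^sup>2) \<in> borel_measurable borel" by measurable
  note * = integral_mult_indep[OF indep[of n], where X = "lam n" and Y = "x n" and
      h = "\<lambda>t. t * (2 - t)" and g = "\<lambda>u. (norm (J n u - u))\<^sup>2", OF _ _ _ _ _ this]
  show "(\<integral>\<omega>. lam n \<omega> * (2 - lam n \<omega>) * (res n \<omega>)\<^sup>2 \<partial>M)
      = (\<integral>\<omega>. lam n \<omega> * (2 - lam n \<omega>) \<partial>M) * (\<integral>\<omega>. (res n \<omega>)\<^sup>2 \<partial>M)"
    unfolding res_def using lam_weight_integrable[of n] res_square_integrable[of n]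
    by (intro *(1)) (auto simp: res_def)
  show "integrable M (\<lambda>\<omega>. lam n \<omega> * (2 - lam n \<omega>) * (res n \<omega>)\<^sup>2)"
    unfolding res_def using lam_weight_integrable[of n] res_square_integrable[of n]
    by (intro *(2)) (auto simp: res_def)
qed

text \<open>\<open>e n\<close> belongs to the same family. The identity turns the error condition of
  case (i) into summability of the \<open>L^2\<close> norms of \<open>err\<close>.\<close>

lemma
  shows integral_err_square:
    "(\<integral>\<omega>. (err n \<omega>)\<^sup>2 \<partial>M) = (\<integral>\<omega>. \<bar>lam n \<omega>\<bar>\<^sup>2 \<partial>M) * (\<integral>\<omega>. (norm (e n \<omega>))\<^sup>2 \<partial>M)"
    and err_square_integrable: "integrable M (\<lambda>\<omega>. (err n \<omega>)\<^sup>2)"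
proof -
  have int: "integrable M (\<lambda>\<omega>. (lam n \<omega>)\<^sup>2)"
  proof (rule bounded_lam_integrable[of "\<lambda>t. t\<^sup>2" "2\<^sup>2"])
    show "\<bar>t\<^sup>2\<bar> \<le> 2\<^sup>2" if "0 < t" "t < 2" for t :: real
      using power_mono[of t 2 2] that by simp
  qed simp
  have "(\<lambda>u::'h. (norm u)\<^sup>2) \<in> borel_measurable borel" by measurable
  note * = integral_mult_indep[OF indep[of n], where X = "lam n" and Y = "e n" and
      h = "\<lambda>t. t\<^sup>2" and g = "\<lambda>u. (norm u)\<^sup>2", OF _ _ _ _ _ this]
  show "(\<integral>\<omega>. (err n \<omega>)\<^sup>2 \<partial>M) = (\<integral>\<omega>. \<bar>lam n \<omega>\<bar>\<^sup>2 \<partial>M) * (\<integral>\<omega>. (norm (e n \<omega>))\<^sup>2 \<partial>M)"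
    unfolding err_def power_mult_distrib power2_abs
    using int e_square_integrable[of n] by (intro *(1)) auto
  show "integrable M (\<lambda>\<omega>. (err n \<omega>)\<^sup>2)"
    unfolding err_def power_mult_distrib
    using int e_square_integrable[of n] by (intro *(2)) auto
qed

text \<open>Brings cases (ii) and (iii) to the same error condition; the factor 2 bounds
  \<open>lam n\<close>.\<close>

lemma summable_err_if_summable_e:
  assumes "summable (\<lambda>n. sqrt (\<integral>\<omega>. (norm (e n \<omega>))\<^sup>2 \<partial>M))"
  shows "summable (\<lambda>n. sqrt (\<integral>\<omega>. (err n \<omega>)\<^sup>2 \<partial>M))"
proof (rule summable_comparison_test'[OF summable_mult[OF assms, of 2]])
  fix n
  have "(\<integral>\<omega>. (err n \<omega>)\<^sup>2 \<partial>M) \<le> (\<integral>\<omega>. 4 * (norm (e n \<omega>))\<^sup>2 \<partial>M)"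
  proof (rule integral_mono_AE)
    show "AE \<omega> in M. (err n \<omega>)\<^sup>2 \<le> 4 * (norm (e n \<omega>))\<^sup>2"
      using lam(2)[of n]
    proof eventually_elim
      case (elim \<omega>)
      then have "(lam n \<omega>)\<^sup>2 \<le> 2\<^sup>2" by (intro power_mono) auto
      then show ?case unfolding err_def power_mult_distrib by (intro mult_right_mono) auto
    qed
  qed (use err_square_integrable e_square_integrable in auto)
  then have "sqrt (\<integral>\<omega>. (err n \<omega>)\<^sup>2 \<partial>M) \<le> sqrt (4 * (\<integral>\<omega>. (norm (e n \<omega>))\<^sup>2 \<partial>M))"
    by simp
  then show "norm (sqrt (\<integral>\<omega>. (err n \<omega>)\<^sup>2 \<partial>M)) \<le> 2 * sqrt (\<integral>\<omega>. (norm (e n \<omega>))\<^sup>2 \<partial>M)"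
    by (simp add: real_sqrt_mult)
qed

text \<open>Iterating the distance bound from \<open>x 0\<close> adds up the errors, whose series
  has an \<open>L^2\<close> bound. One \<Phi> for distances and error sum controls both factors of
  the cross terms.\<close>

lemma dominating_function:
  assumes "summable (\<lambda>n. sqrt (\<integral>\<omega>. (err n \<omega>)\<^sup>2 \<partial>M))" and z: "z \<in> zer A"
  obtains \<Phi> where "\<Phi> \<in> borel_measurable M" "integrable M (\<lambda>\<omega>. (\<Phi> \<omega>)\<^sup>2)"
    "AE \<omega> in M. summable (\<lambda>n. err n \<omega>) \<and> (\<Sum>n. err n \<omega>) \<le> \<Phi> \<omega> \<and> (\<forall>n. norm (x n \<omega> - z) \<le> \<Phi> \<omega>)"
proof -
  have nonneg: "AE \<omega> in M. 0 \<le> err n \<omega>" for n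
    using AE_good by eventually_elim (rule err_nonneg)
  obtain \<Psi> where [measurable]: "\<Psi> \<in> borel_measurable M" and int: "integrable M (\<lambda>\<omega>. (\<Psi> \<omega>)\<^sup>2)"
    and \<Psi>: "AE \<omega> in M. summable (\<lambda>n. err n \<omega>) \<and> (\<Sum>n. err n \<omega>) \<le> \<Psi> \<omega> \<and> 0 \<le> \<Psi> \<omega>"
    by (rule L2_summable_dominated[OF err_square_integrable nonneg assms(1)])
  show thesis
  proof (rule that[of "\<lambda>\<omega>. norm (x 0 \<omega>) + norm z + \<Psi> \<omega>"])
    show "integrable M (\<lambda>\<omega>. (norm (x 0 \<omega>) + norm z + \<Psi> \<omega>)\<^sup>2)"
    proof (rule Bochner_Integration.integrable_bound)
      show "integrable M (\<lambda>\<omega>. 3 * ((norm (x 0 \<omega>))\<^sup>2 + (norm z)\<^sup>2 + (\<Psi> \<omega>)\<^sup>2))"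
        using x_L2[of 0] int by (simp add: L2_def)
      show "AE \<omega> in M. norm ((norm (x 0 \<omega>) + norm z + \<Psi> \<omega>)\<^sup>2)
          \<le> norm (3 * ((norm (x 0 \<omega>))\<^sup>2 + (norm z)\<^sup>2 + (\<Psi> \<omega>)\<^sup>2))"
        unfolding real_norm_def abs_power2
        by (intro AE_I2 order_trans[OF power2_sum3_le abs_ge_self])
    qed measurable
    show "AE \<omega> in M. summable (\<lambda>n. err n \<omega>) \<and> (\<Sum>n. err n \<omega>) \<le> norm (x 0 \<omega>) + norm z + \<Psi> \<omega> \<and>
        (\<forall>n. norm (x n \<omega> - z) \<le> norm (x 0 \<omega>) + norm z + \<Psi> \<omega>)"
      using \<Psi> AE_good
    proof eventually_elim
      case (elim \<omega>)
      have "norm (x n \<omega> - z) \<le> norm (x 0 \<omega>) + norm z + (\<Sum>k<n. err k \<omega>)" for n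
      proof (induction n)
        case (Suc n)
        then show ?case using good_dist(1)[OF elim(2) z, of n] by simp
      qed (simp add: norm_triangle_ineq4)
      moreover have "(\<Sum>k<n. err k \<omega>) \<le> (\<Sum>k. err k \<omega>)" for n
        using elim err_nonneg by (intro sum_le_suminf) auto
      ultimately have "norm (x n \<omega> - z) \<le> norm (x 0 \<omega>) + norm z + (\<Sum>k. err k \<omega>)" for n
        by (meson add_left_mono order_trans)
      then show ?case using elim(1)
        by (auto intro: order_trans[OF _ add_left_mono] add_increasing)
    qed
  qed measurable
qed

text \<open>Telescope the squared inequality along a path, integrate, and factor each term by
  independence.\<close>

lemma summable_weight_res:
  assumes "summable (\<lambda>n. sqrt (\<integral>\<omega>. (err n \<omega>)\<^sup>2 \<partial>M))"
  shows "summable (\<lambda>n. (\<integral>\<omega>. lam n \<omega> * (2 - lam n \<omega>) \<partial>M) * (\<integral>\<omega>. (res n \<omega>)\<^sup>2 \<partial>M))"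
proof -
  obtain z where z: "z \<in> zer A" using A(2) by blast
  obtain \<Phi> where int: "integrable M (\<lambda>\<omega>. (\<Phi> \<omega>)\<^sup>2)"
    and \<Phi>: "AE \<omega> in M. summable (\<lambda>n. err n \<omega>) \<and> (\<Sum>n. err n \<omega>) \<le> \<Phi> \<omega> \<and>
      (\<forall>n. norm (x n \<omega> - z) \<le> \<Phi> \<omega>)"
    using dominating_function[OF assms z] by blast
  define d where "d n \<omega> = lam n \<omega> * (2 - lam n \<omega>) * (res n \<omega>)\<^sup>2" for n \<omega>
  \<comment> \<open>Of the constant 3, one comes from the initial squared distance and two from the
    cross terms.\<close>
  have le: "AE \<omega> in M. (\<Sum>n<N. d n \<omega>) \<le> 3 * (\<Phi> \<omega>)\<^sup>2" for N
    using \<Phi> AE_good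
  proof eventually_elim
    case (elim \<omega>)
    have \<Phi>0: "0 \<le> \<Phi> \<omega>" using elim(1) norm_ge_zero order_trans by blast
    have "(\<Sum>n<k. d n \<omega>) \<le> (norm (x 0 \<omega> - z))\<^sup>2 - (norm (x k \<omega> - z))\<^sup>2
        + 2 * \<Phi> \<omega> * (\<Sum>n<k. err n \<omega>)" for k
    proof (induction k)
      case (Suc k)
      have "2 * norm (x (Suc k) \<omega> - z) * err k \<omega> \<le> 2 * \<Phi> \<omega> * err k \<omega>"
        using elim err_nonneg by (intro mult_right_mono) auto
      then show ?case using Suc good_dist(2)[OF elim(2) z, of k]
        by (simp add: d_def distrib_left)
    qed simp
    also have "(norm (x 0 \<omega> - z))\<^sup>2 - (norm (x N \<omega> - z))\<^sup>2 + 2 * \<Phi> \<omega> * (\<Sum>n<N. err n \<omega>)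
        \<le> (\<Phi> \<omega>)\<^sup>2 - 0 + 2 * \<Phi> \<omega> * \<Phi> \<omega>"
    proof (intro add_mono diff_mono mult_left_mono)
      show "(norm (x 0 \<omega> - z))\<^sup>2 \<le> (\<Phi> \<omega>)\<^sup>2" using elim(1) by (intro power_mono) auto
      have "(\<Sum>n<N. err n \<omega>) \<le> (\<Sum>n. err n \<omega>)"
        using elim err_nonneg by (intro sum_le_suminf) auto
      then show "(\<Sum>n<N. err n \<omega>) \<le> \<Phi> \<omega>" using elim(1) by linarith
    qed (use \<Phi>0 in auto)
    finally show ?case by (simp add: power2_eq_square)
  qed
  have d_int: "integrable M (d n)" for n
    unfolding d_def[abs_def] by (rule integrable_weight_res)
  have "summable (\<lambda>n. \<integral>\<omega>. d n \<omega> \<partial>M)"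
  proof (rule summableI_nonneg_bounded)
    show "0 \<le> (\<integral>\<omega>. d n \<omega> \<partial>M)" for n
      unfolding d_def integral_weight_res by (simp add: lam_weight_nonneg)
    show "(\<Sum>n<N. \<integral>\<omega>. d n \<omega> \<partial>M) \<le> (\<integral>\<omega>. 3 * (\<Phi> \<omega>)\<^sup>2 \<partial>M)" for N
    proof -
      have "(\<Sum>n<N. \<integral>\<omega>. d n \<omega> \<partial>M) = (\<integral>\<omega>. (\<Sum>n<N. d n \<omega>) \<partial>M)"
        using d_int by (intro Bochner_Integration.integral_sum[symmetric])
      also have "\<dots> \<le> (\<integral>\<omega>. 3 * (\<Phi> \<omega>)\<^sup>2 \<partial>M)"
        using d_int int le by (intro integral_mono_AE) auto
      finally show ?thesis .
    qed
  qed
  then show ?thesis unfolding d_def integral_weight_res .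
qed

text \<open>The limit is chosen path by path; its measurability comes from the almost sure limits of
  inner products with fixed vectors. Norm bounds survive weak limits, which puts it into
  \<open>L2 M\<close> and allows dominated convergence.\<close>

lemma weak_convergence_if_AE_weakly_converges:
  assumes summ: "summable (\<lambda>n. sqrt (\<integral>\<omega>. (err n \<omega>)\<^sup>2 \<partial>M))"
    and lim: "AE \<omega> in M. \<exists>l\<in>zer A. weakly_converges (\<lambda>n. x n \<omega>) l"
  shows "\<exists>xinf. xinf \<in> borel_measurable M \<and> (AE \<omega> in M. xinf \<omega> \<in> zer A) \<and>
    (AE \<omega> in M. weakly_converges (\<lambda>n. x n \<omega>) (xinf \<omega>)) \<and> weakly_converges_L2 M x xinf"
proof -
  obtain z where z: "z \<in> zer A" using A(2) by blast
  obtain \<Phi> where [measurable]: "\<Phi> \<in> borel_measurable M" and int: "integrable M (\<lambda>\<omega>. (\<Phi> \<omega>)\<^sup>2)"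
    and \<Phi>: "AE \<omega> in M. summable (\<lambda>n. err n \<omega>) \<and> (\<Sum>n. err n \<omega>) \<le> \<Phi> \<omega> \<and>
      (\<forall>n. norm (x n \<omega> - z) \<le> \<Phi> \<omega>)"
    by (rule dominating_function[OF summ z])
  define xinf where "xinf \<omega> = (SOME l. l \<in> zer A \<and> weakly_converges (\<lambda>n. x n \<omega>) l)" for \<omega>
  have xinf: "AE \<omega> in M. xinf \<omega> \<in> zer A \<and> weakly_converges (\<lambda>n. x n \<omega>) (xinf \<omega>)"
    using lim
  proof eventually_elim
    case (elim \<omega>)
    then have "\<exists>l. l \<in> zer A \<and> weakly_converges (\<lambda>n. x n \<omega>) l" by blast
    then show ?case unfolding xinf_def by (rule someI_ex)
  qed
  have xinf_meas [measurable]: "xinf \<in> borel_measurable M"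
  proof (rule borel_measurable_if_inner_measurable)
    fix y
    show "(\<lambda>\<omega>. xinf \<omega> \<bullet> y) \<in> borel_measurable M"
    proof (rule measurable_cong_AE)
      show "(\<lambda>\<omega>. lim (\<lambda>n. x n \<omega> \<bullet> y)) \<in> borel_measurable M" by measurable
      show "AE \<omega> in M. lim (\<lambda>n. x n \<omega> \<bullet> y) = xinf \<omega> \<bullet> y"
        using xinf by eventually_elim (auto simp: weakly_converges_def intro: limI)
    qed simp
  qed
  define w where "w \<omega> = 2 * ((\<Phi> \<omega>)\<^sup>2 + (norm z)\<^sup>2)" for \<omega>
  have w_int: "integrable M w" unfolding w_def[abs_def] using int by simp
  have le_w: "(norm u)\<^sup>2 \<le> w \<omega>" if "norm u \<le> \<Phi> \<omega> + norm z" for u :: 'h and \<omega>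
  proof -
    have "(norm u)\<^sup>2 \<le> (\<Phi> \<omega> + norm z)\<^sup>2" using that by (rule power_mono) simp
    also have "\<dots> \<le> w \<omega>"
      using zero_le_power2[of "\<Phi> \<omega> - norm z"] by (simp add: w_def power2_sum power2_diff)
    finally show ?thesis .
  qed
  have x_le: "AE \<omega> in M. \<forall>n. norm (x n \<omega>) \<le> \<Phi> \<omega> + norm z"
    using \<Phi>
  proof eventually_elim
    case (elim \<omega>)
    have "norm (x n \<omega>) \<le> norm (x n \<omega> - z) + norm z" for n
      using norm_triangle_ineq[of "x n \<omega> - z" z] by simp
    then show ?case using elim by (meson add_right_mono order_trans)
  qed
  have xinf_le: "AE \<omega> in M. norm (xinf \<omega>) \<le> \<Phi> \<omega> + norm z"
    using x_le xinf by eventually_elim (blast intro: weakly_converges_norm_le)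
  have xinf_L2: "xinf \<in> L2 M"
  proof -
    have "integrable M (\<lambda>\<omega>. (norm (xinf \<omega>))\<^sup>2)"
    proof (rule Bochner_Integration.integrable_bound[OF w_int])
      show "AE \<omega> in M. norm ((norm (xinf \<omega>))\<^sup>2) \<le> norm (w \<omega>)"
        using xinf_le by eventually_elim (use le_w in \<open>auto intro: order_trans[OF _ abs_ge_self]\<close>)
    qed measurable
    then show ?thesis using xinf_meas by (simp add: L2_def)
  qed
  have "(\<lambda>n. \<integral>\<omega>. x n \<omega> \<bullet> g \<omega> \<partial>M) \<longlonglongrightarrow> (\<integral>\<omega>. xinf \<omega> \<bullet> g \<omega> \<partial>M)" if g: "g \<in> L2 M" for g
  proof (rule integral_dominated_convergence)
    have [measurable]: "g \<in> borel_measurable M" using g by (simp add: L2_def)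
    show "(\<lambda>\<omega>. xinf \<omega> \<bullet> g \<omega>) \<in> borel_measurable M" "(\<lambda>\<omega>. x n \<omega> \<bullet> g \<omega>) \<in> borel_measurable M" for n
      by measurable
    show "integrable M (\<lambda>\<omega>. w \<omega> + (norm (g \<omega>))\<^sup>2)" using w_int g by (simp add: L2_def)
    show "AE \<omega> in M. (\<lambda>n. x n \<omega> \<bullet> g \<omega>) \<longlonglongrightarrow> xinf \<omega> \<bullet> g \<omega>"
      using xinf by eventually_elim (simp add: weakly_converges_def)
    show "AE \<omega> in M. norm (x n \<omega> \<bullet> g \<omega>) \<le> w \<omega> + (norm (g \<omega>))\<^sup>2" for n
      using x_le
    proof eventually_elim
      case (elim \<omega>)
      have "norm (x n \<omega> \<bullet> g \<omega>) \<le> norm (x n \<omega>) * norm (g \<omega>)"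
        using Cauchy_Schwarz_ineq2 by simp
      also have "\<dots> \<le> (norm (x n \<omega>))\<^sup>2 + (norm (g \<omega>))\<^sup>2"
        using sum_squares_bound[of "norm (x n \<omega>)" "norm (g \<omega>)"]
          mult_nonneg_nonneg[OF norm_ge_zero[of "x n \<omega>"] norm_ge_zero[of "g \<omega>"]] by linarith
      also have "(norm (x n \<omega>))\<^sup>2 \<le> w \<omega>" using elim by (intro le_w) blast
      finally show ?case by simp
    qed
  qed
  then have "weakly_converges_L2 M x xinf"
    unfolding weakly_converges_L2_def using x_L2 xinf_L2 by blast
  then show ?thesis using xinf xinf_meas by (intro exI[of _ xinf]) auto
qed

text \<open>The graph point at \<open>J n (x n \<omega>)\<close> has an image of norm
  \<open>res n \<omega> / \<gamma> n\<close>; the lower bound on \<open>\<gamma>\<close> makes it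
  vanish with the residual.\<close>

lemma AE_weakly_converges_if_residual:
  assumes summ: "summable (\<lambda>n. sqrt (\<integral>\<omega>. (err n \<omega>)\<^sup>2 \<partial>M))"
    and res: "AE \<omega> in M. (\<lambda>n. res n \<omega>) \<longlonglongrightarrow> 0" and c: "0 < c" "\<And>n. c \<le> \<gamma> n"
  shows "AE \<omega> in M. \<exists>l\<in>zer A. weakly_converges (\<lambda>n. x n \<omega>) l"
proof -
  obtain z where "z \<in> zer A" using A(2) by blast
  from dominating_function[OF summ this]
  have "AE \<omega> in M. summable (\<lambda>n. err n \<omega>)" by (auto elim: eventually_mono)
  then show ?thesis using res AE_good
  proof eventually_elim
    case (elim \<omega>)
    let ?u = "\<lambda>n. (1 / \<gamma> n) *\<^sub>R (x n \<omega> - J n (x n \<omega>))"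
    have p: "(\<lambda>n. x n \<omega> - J n (x n \<omega>)) \<longlonglongrightarrow> 0"
      using elim(2) tendsto_norm_zero_cancel
      by (auto simp: res_def norm_minus_commute)
    show ?case
    proof (rule weakly_converges_zer[OF A _ elim(1) _ _ p])
      show "norm (x (Suc n) \<omega> - z) \<le> norm (x n \<omega> - z) + err n \<omega>" if "z \<in> zer A" for z n
        using good_dist(1)[OF elim(3) that] .
      show "?u n \<in> A (J n (x n \<omega>))" for n
        unfolding J_def by (rule resolvent_mem[OF A(1) \<gamma>])
      show "?u \<longlonglongrightarrow> 0"
      proof (rule Lim_null_comparison)
        show "\<forall>\<^sub>F n in sequentially. norm (?u n) \<le> (1 / c) * res n \<omega>"
        proof (intro always_eventually allI)
          fix n
          have "norm (?u n) = (1 / \<gamma> n) * res n \<omega>"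
            using \<gamma>[of n] by (simp add: res_def norm_minus_commute)
          also have "\<dots> \<le> (1 / c) * res n \<omega>"
            using c \<gamma>[of n] by (intro mult_right_mono divide_left_mono res_nonneg) auto
          finally show "norm (?u n) \<le> (1 / c) * res n \<omega>" .
        qed
        show "(\<lambda>n. (1 / c) * res n \<omega>) \<longlonglongrightarrow> 0"
          using tendsto_mult_left[OF elim(2), of "1 / c"] by simp
      qed
    qed
  qed
qed

lemma residual_tendsto_if_weight_bounded_below:
  assumes summ: "summable (\<lambda>n. sqrt (\<integral>\<omega>. (err n \<omega>)\<^sup>2 \<partial>M))"
    and c: "0 < c" "\<And>n. c \<le> (\<integral>\<omega>. lam n \<omega> * (2 - lam n \<omega>) \<partial>M)"
  shows "AE \<omega> in M. (\<lambda>n. res n \<omega>) \<longlonglongrightarrow> 0"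
proof -
  have "summable (\<lambda>n. \<integral>\<omega>. (res n \<omega>)\<^sup>2 \<partial>M)"
  proof (rule summable_comparison_test'[OF summable_mult[OF summable_weight_res[OF summ], of "1 / c"]])
    fix n
    have "c * (\<integral>\<omega>. (res n \<omega>)\<^sup>2 \<partial>M)
        \<le> (\<integral>\<omega>. lam n \<omega> * (2 - lam n \<omega>) \<partial>M) * (\<integral>\<omega>. (res n \<omega>)\<^sup>2 \<partial>M)"
      by (intro mult_right_mono c(2)) simp
    then show "norm (\<integral>\<omega>. (res n \<omega>)\<^sup>2 \<partial>M)
        \<le> 1 / c * ((\<integral>\<omega>. lam n \<omega> * (2 - lam n \<omega>) \<partial>M) * (\<integral>\<omega>. (res n \<omega>)\<^sup>2 \<partial>M))"
      using c(1) by (simp add: pos_le_divide_eq mult.commute)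
  qed
  then have "AE \<omega> in M. summable (\<lambda>n. (res n \<omega>)\<^sup>2)"
    by (intro AE_summable_if_summable_integral res_square_integrable) auto
  then show ?thesis
  proof eventually_elim
    case (elim \<omega>)
    have "(\<lambda>n. sqrt ((res n \<omega>)\<^sup>2)) \<longlonglongrightarrow> sqrt 0"
      by (intro tendsto_real_sqrt summable_LIMSEQ_zero elim)
    then show ?case using res_nonneg by simp
  qed
qed

text \<open>Quasi-decreasing residuals converge almost surely, so their expected squares converge as
  well. A positive limit \<open>c\<close> would eventually bound the weights by \<open>2 / c\<close>
  times a summable sequence.\<close>

lemma residual_tendsto_if_weight_not_summable:
  assumes summ: "summable (\<lambda>n. sqrt (\<integral>\<omega>. (err n \<omega>)\<^sup>2 \<partial>M))"
    and weight: "\<not> summable (\<lambda>n. \<integral>\<omega>. lam n \<omega> * (2 - lam n \<omega>) \<partial>M)"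
    and \<gamma>1: "\<And>n. \<gamma> n = 1"
  shows "AE \<omega> in M. (\<lambda>n. res n \<omega>) \<longlonglongrightarrow> 0"
proof -
  obtain z where z: "z \<in> zer A" using A(2) by blast
  obtain \<Phi> where [measurable]: "\<Phi> \<in> borel_measurable M" and int: "integrable M (\<lambda>\<omega>. (\<Phi> \<omega>)\<^sup>2)"
    and \<Phi>: "AE \<omega> in M. summable (\<lambda>n. err n \<omega>) \<and> (\<Sum>n. err n \<omega>) \<le> \<Phi> \<omega> \<and>
      (\<forall>n. norm (x n \<omega> - z) \<le> \<Phi> \<omega>)"
    by (rule dominating_function[OF summ z])
  define \<rho> where "\<rho> \<omega> = lim (\<lambda>n. res n \<omega>)" for \<omega>
  have [measurable]: "\<rho> \<in> borel_measurable M" unfolding \<rho>_def[abs_def] by measurable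
  have conv: "AE \<omega> in M. (\<lambda>n. res n \<omega>) \<longlonglongrightarrow> \<rho> \<omega>"
    using \<Phi> AE_good
  proof eventually_elim
    case (elim \<omega>)
    \<comment> \<open>Comparing consecutive residuals requires the same resolvent at both points,
      hence \<open>\<gamma>1\<close>.\<close>
    have "res (Suc n) \<omega> \<le> res n \<omega> + err n \<omega>" for n
    proof -
      have "0 \<le> lam n \<omega>" "lam n \<omega> \<le> 2"
        "x (Suc n) \<omega> = x n \<omega> + lam n \<omega> *\<^sub>R (resolvent 1 A (x n \<omega>) - e n \<omega> - x n \<omega>)"
        using elim(2) by (auto simp: good_def J_def \<gamma>1 less_imp_le)
      then show ?thesis
        unfolding res_def err_def J_def \<gamma>1 by (intro resolvent_residual_step[OF A(1)]) simp
    qed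
    then have "convergent (\<lambda>n. res n \<omega>)"
      using elim(1) by (intro convergent_quasi_decreasing[OF res_nonneg]) auto
    then show ?case unfolding \<rho>_def by (simp add: convergent_LIMSEQ_iff)
  qed
  have bound: "AE \<omega> in M. norm ((res n \<omega>)\<^sup>2) \<le> (\<Phi> \<omega>)\<^sup>2" for n
    using \<Phi>
  proof eventually_elim
    case (elim \<omega>)
    then have "res n \<omega> \<le> \<Phi> \<omega>" using res_le_dist[OF z] order_trans by blast
    then show ?case using res_nonneg[of n \<omega>] by (simp add: power_mono)
  qed
  have conv2: "AE \<omega> in M. (\<lambda>n. (res n \<omega>)\<^sup>2) \<longlonglongrightarrow> (\<rho> \<omega>)\<^sup>2"
    using conv by eventually_elim (rule tendsto_power)
  have lim: "(\<lambda>n. \<integral>\<omega>. (res n \<omega>)\<^sup>2 \<partial>M) \<longlonglongrightarrow> (\<integral>\<omega>. (\<rho> \<omega>)\<^sup>2 \<partial>M)"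
    by (rule integral_dominated_convergence[OF _ _ int conv2 bound]) measurable
  have \<rho>_int: "integrable M (\<lambda>\<omega>. (\<rho> \<omega>)\<^sup>2)"
    by (rule integrable_dominated_convergence[OF _ _ int conv2 bound]) measurable
  have "(\<integral>\<omega>. (\<rho> \<omega>)\<^sup>2 \<partial>M) = 0"
  proof (rule ccontr)
    define c where "c = (\<integral>\<omega>. (\<rho> \<omega>)\<^sup>2 \<partial>M)"
    assume "(\<integral>\<omega>. (\<rho> \<omega>)\<^sup>2 \<partial>M) \<noteq> 0"
    then have "c \<noteq> 0" by (simp add: c_def)
    moreover have "0 \<le> c" by (simp add: c_def)
    ultimately have c: "0 < c" by linarith
    then have "\<forall>\<^sub>F n in sequentially. c / 2 < (\<integral>\<omega>. (res n \<omega>)\<^sup>2 \<partial>M)"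
      using lim by (intro order_tendstoD) (auto simp: c_def)
    then obtain N where N: "\<And>n. n \<ge> N \<Longrightarrow> c / 2 < (\<integral>\<omega>. (res n \<omega>)\<^sup>2 \<partial>M)"
      by (auto simp: eventually_sequentially)
    have "summable (\<lambda>n. \<integral>\<omega>. lam n \<omega> * (2 - lam n \<omega>) \<partial>M)"
    proof (rule summable_comparison_test'[OF summable_mult[OF summable_weight_res[OF summ], of "2 / c"]])
      fix n assume "n \<ge> N"
      then have "(\<integral>\<omega>. lam n \<omega> * (2 - lam n \<omega>) \<partial>M) * (c / 2)
          \<le> (\<integral>\<omega>. lam n \<omega> * (2 - lam n \<omega>) \<partial>M) * (\<integral>\<omega>. (res n \<omega>)\<^sup>2 \<partial>M)"
        using N by (intro mult_left_mono lam_weight_nonneg) (simp add: less_imp_le)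
      then show "norm (\<integral>\<omega>. lam n \<omega> * (2 - lam n \<omega>) \<partial>M)
          \<le> 2 / c * ((\<integral>\<omega>. lam n \<omega> * (2 - lam n \<omega>) \<partial>M) * (\<integral>\<omega>. (res n \<omega>)\<^sup>2 \<partial>M))"
        using c lam_weight_nonneg[of n] by (simp add: pos_le_divide_eq mult.commute)
    qed
    then show False using weight by blast
  qed
  then have "AE \<omega> in M. \<rho> \<omega> = 0"
    using integral_nonneg_eq_0_iff_AE[OF \<rho>_int] by simp
  then show ?thesis using conv by eventually_elim simp
qed

text \<open>With \<open>lam n \<omega> = 1\<close> the old point cancels from the recursion and
  \<open>err n \<omega>\<close> is \<open>norm (e n \<omega>)\<close>, so the errors are summable on
  almost every path.\<close>

lemma AE_weakly_converges_unrelaxed: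
  assumes summ: "summable (\<lambda>n. sqrt (\<integral>\<omega>. (err n \<omega>)\<^sup>2 \<partial>M))"
    and lam1: "\<And>n. AE \<omega> in M. lam n \<omega> = 1" and \<gamma>2: "\<not> summable (\<lambda>n. (\<gamma> n)\<^sup>2)"
  shows "AE \<omega> in M. \<exists>l\<in>zer A. weakly_converges (\<lambda>n. x n \<omega>) l"
proof -
  obtain z where "z \<in> zer A" using A(2) by blast
  from dominating_function[OF summ this]
  have "AE \<omega> in M. summable (\<lambda>n. err n \<omega>)" by (auto elim: eventually_mono)
  moreover have "AE \<omega> in M. \<forall>n. lam n \<omega> = 1" using lam1 by (simp add: AE_all_countable)
  ultimately show ?thesis using AE_good
  proof eventually_elim
    case (elim \<omega>)
    show ?case
    proof (rule inexact_proximal_point_weakly_converges[OF A \<gamma> \<gamma>2])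
      show "summable (\<lambda>n. norm (e n \<omega>))" using elim(1,2) by (simp add: err_def)
      show "x (Suc n) \<omega> = resolvent (\<gamma> n) A (x n \<omega>) - e n \<omega>" for n
        using elim(2,3) by (simp add: good_def J_def)
    qed
  qed
qed

end

theorem theorem4p1:
  fixes M :: "'a measure"
    and A :: "'h::{real_inner, polish_space} \<Rightarrow> 'h set"
    and \<gamma> :: "nat \<Rightarrow> real"
    and x e :: "nat \<Rightarrow> 'a \<Rightarrow> 'h"
    and lam :: "nat \<Rightarrow> 'a \<Rightarrow> real"
  assumes prob: "prob_space M" and complete: "complete_measure M"
    and A: "maximally_monotone A" "zer A \<noteq> {}"
    and \<gamma>: "\<And>n. \<gamma> n > 0"
    and x0: "x 0 \<in> L2 M"
    and e: "\<And>n. e n \<in> L2 M"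
    and lam: "\<And>n. lam n \<in> borel_measurable M" "\<And>n. AE \<omega> in M. lam n \<omega> \<in> {0<..<2}"
    and step: "\<And>n. AE \<omega> in M.
      x (Suc n) \<omega> = x n \<omega> + lam n \<omega> *\<^sub>R (resolvent (\<gamma> n) A (x n \<omega>) - e n \<omega> - x n \<omega>)"
    and indep: "\<And>n. prob_space.indep_set M
      (generated_sigma M {lam n}) (generated_sigma M (x ` {0..n} \<union> {e n}))"
    and cases:
      "((\<Sum>n. ennreal (\<integral>\<omega>. lam n \<omega> * (2 - lam n \<omega>) \<partial>M)) = \<infinity> \<and>
        (\<Sum>n. ennreal (sqrt ((\<integral>\<omega>. \<bar>lam n \<omega>\<bar>\<^sup>2 \<partial>M) * (\<integral>\<omega>. (norm (e n \<omega>))\<^sup>2 \<partial>M)))) < \<infinity> \<and>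
        bounded (range (\<lambda>n. \<integral>\<omega>. (norm (e n \<omega>))\<^sup>2 \<partial>M)) \<and>
        (\<forall>n. \<gamma> n = 1))
     \<or> ((INF n. \<integral>\<omega>. lam n \<omega> * (2 - lam n \<omega>) \<partial>M) > 0 \<and>
        (INF n. \<gamma> n) > 0 \<and>
        (\<Sum>n. ennreal (sqrt (\<integral>\<omega>. (norm (e n \<omega>))\<^sup>2 \<partial>M))) < \<infinity>)
     \<or> ((\<Sum>n. ennreal ((\<gamma> n)\<^sup>2)) = \<infinity> \<and>
        (\<Sum>n. ennreal (sqrt (\<integral>\<omega>. (norm (e n \<omega>))\<^sup>2 \<partial>M))) < \<infinity> \<and>
        (\<forall>n. AE \<omega> in M. lam n \<omega> = 1))"
  shows "\<exists>xinf. xinf \<in> borel_measurable M \<and>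
           (AE \<omega> in M. xinf \<omega> \<in> zer A) \<and>
           (AE \<omega> in M. weakly_converges (\<lambda>n. x n \<omega>) (xinf \<omega>)) \<and>
           weakly_converges_L2 M x xinf"
proof -
  interpret random_inexact_proximal M A \<gamma> x e lam
    by (intro random_inexact_proximal.intro random_inexact_proximal_axioms.intro) fact+
  have e_summable: "summable (\<lambda>n. sqrt (\<integral>\<omega>. (norm (e n \<omega>))\<^sup>2 \<partial>M))"
    if "(\<Sum>n. ennreal (sqrt (\<integral>\<omega>. (norm (e n \<omega>))\<^sup>2 \<partial>M))) < \<infinity>"
    using that by (intro summable_suminf_not_top) auto
  show ?thesis
    using cases
  proof (elim disjE conjE)
    assume weight: "(\<Sum>n. ennreal (\<integral>\<omega>. lam n \<omega> * (2 - lam n \<omega>) \<partial>M)) = \<infinity>"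
      and err: "(\<Sum>n. ennreal (sqrt ((\<integral>\<omega>. \<bar>lam n \<omega>\<bar>\<^sup>2 \<partial>M) * (\<integral>\<omega>. (norm (e n \<omega>))\<^sup>2 \<partial>M)))) < \<infinity>"
      and \<gamma>1: "\<forall>n. \<gamma> n = 1"
    have summ: "summable (\<lambda>n. sqrt (\<integral>\<omega>. (err n \<omega>)\<^sup>2 \<partial>M))"
      using err unfolding integral_err_square by (intro summable_suminf_not_top) auto
    have "\<not> summable (\<lambda>n. \<integral>\<omega>. lam n \<omega> * (2 - lam n \<omega>) \<partial>M)"
      using weight ennreal_suminf_neq_top[OF _ lam_weight_nonneg] by auto
    then have "AE \<omega> in M. (\<lambda>n. res n \<omega>) \<longlonglongrightarrow> 0"
      using \<gamma>1 by (intro residual_tendsto_if_weight_not_summable[OF summ]) auto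
    from AE_weakly_converges_if_residual[OF summ this, of 1] show ?thesis
      using \<gamma>1 by (intro weak_convergence_if_AE_weakly_converges[OF summ]) simp
  next
    assume weight: "(INF n. \<integral>\<omega>. lam n \<omega> * (2 - lam n \<omega>) \<partial>M) > 0" and \<gamma>_inf: "(INF n. \<gamma> n) > 0"
      and "(\<Sum>n. ennreal (sqrt (\<integral>\<omega>. (norm (e n \<omega>))\<^sup>2 \<partial>M))) < \<infinity>"
    then have summ: "summable (\<lambda>n. sqrt (\<integral>\<omega>. (err n \<omega>)\<^sup>2 \<partial>M))"
      by (intro summable_err_if_summable_e e_summable)
    \<comment> \<open>The real infimum bounds each term because nonnegativity bounds the range from
      below.\<close>
    have "(INF n. \<integral>\<omega>. lam n \<omega> * (2 - lam n \<omega>) \<partial>M) \<le> (\<integral>\<omega>. lam k \<omega> * (2 - lam k \<omega>) \<partial>M)" for k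
      using lam_weight_nonneg by (intro cINF_lower bdd_belowI[of _ 0]) auto
    then have "AE \<omega> in M. (\<lambda>n. res n \<omega>) \<longlonglongrightarrow> 0"
      by (rule residual_tendsto_if_weight_bounded_below[OF summ weight])
    moreover have "(INF n. \<gamma> n) \<le> \<gamma> k" for k
      using \<gamma> by (intro cINF_lower bdd_belowI[of _ 0]) (auto simp: less_imp_le)
    ultimately show ?thesis
      by (intro weak_convergence_if_AE_weakly_converges[OF summ]
          AE_weakly_converges_if_residual[OF summ _ \<gamma>_inf])
  next
    assume \<gamma>2: "(\<Sum>n. ennreal ((\<gamma> n)\<^sup>2)) = \<infinity>" and lam1: "\<forall>n. AE \<omega> in M. lam n \<omega> = 1"
      and "(\<Sum>n. ennreal (sqrt (\<integral>\<omega>. (norm (e n \<omega>))\<^sup>2 \<partial>M))) < \<infinity>"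
    then have summ: "summable (\<lambda>n. sqrt (\<integral>\<omega>. (err n \<omega>)\<^sup>2 \<partial>M))"
      by (intro summable_err_if_summable_e e_summable)
    have "\<not> summable (\<lambda>n. (\<gamma> n)\<^sup>2)"
      using \<gamma>2 ennreal_suminf_neq_top[of "\<lambda>n. (\<gamma> n)\<^sup>2"] by auto
    from AE_weakly_converges_unrelaxed[OF summ _ this] show ?thesis
      using lam1 by (intro weak_convergence_if_AE_weakly_converges[OF summ]) blast
  qed
qed

end
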